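(* (1) There are continuum many (i.e. $2^{\aleph_0}$) monoid varieties $\mathbb{W}$ with $\mathbb{M}(\mathbf{z}_\infty)\subseteq \mathbb{W}\subseteq [\![x^2y\approx yx^2]\!]\wedge \mathbb{B}_2^1$. (2) The monoid variety $\mathbb{M}(\mathbf{z}_\infty)$ is not defined within $\mathbb{B}_2^1$ by any finite system of identities; that is, there is no finite set $\Sigma$ of monoid identities such that $\mathbb{M}(\mathbf{z}_\infty)=\mathbb{B}_2^1\cap[\![\Sigma]\!]$.
   Context: ${\bf B}_2^1$ is the six-element Brandt monoid, with monoid presentation $\langle \mathsf{a},\mathsf{b}\mid \mathsf{a}\mathsf{b}\mathsf{a}=\mathsf{a},\ \mathsf{b}\mathsf{a}\mathsf{b}=\mathsf{b},\ \mathsf{a}\mathsf{a}=\mathsf{b}\mathsf{b}=0\rangle$, and $\mathbb{B}_2^1$ is the monoid variety it generates. Let $x_0,x_1,\dots$ be pairwise distinct letters; the Zimin words are $\mathbf{z}_0=x_0$, $\mathbf{z}_{n+1}=\mathbf{z}_nx_{n+1}\mathbf{z}_n$, and $\mathbf{z}_\infty$ is the right-infinite word that is their limit. $S(\mathbf{z}_\infty)$ is the semigroup whose elements are a zero $0$ together with all finite nonempty factors (contiguous subwords) of $\mathbf{z}_\infty$, with product $\mathbf{u}\cdot\mathbf{v}=\mathbf{u}\mathbf{v}$ if $\mathbf{u}\mathbf{v}$ is a factor of $\mathbf{z}_\infty$ and $0$ otherwise; $M(\mathbf{z}_\infty)$ is $S(\mathbf{z}_\infty)$ with an identity element adjoined,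 and $\mathbb{M}(\mathbf{z}_\infty)$ is the monoid variety generated by $M(\mathbf{z}_\infty)$. For a set $\Sigma$ of monoid identities, $[\![\Sigma]\!]$ is the monoid variety it defines; $\wedge$ denotes intersection of varieties. *)

theory Defs
  imports "HOL-Algebra.Product_Groups"
begin

section \<open>Monoid identities\<close>

text \<open>
  Words over the countable alphabet of letters \<open>x\<^sub>0, x\<^sub>1, \<dots>\<close> are lists of naturals. An identity
  \<open>u \<approx> v\<close> is a pair of possibly empty words: the empty word evaluates to the identity element.
\<close>

type_synonym word = "nat list"
type_synonym identity = "word \<times> word"

definition eval_word :: "('a, 'm) monoid_scheme \<Rightarrow> (nat \<Rightarrow> 'a) \<Rightarrow> word \<Rightarrow> 'a" where
  "eval_word M \<phi> w = foldr (\<lambda>x p. \<phi> x \<otimes>\<^bsub>M\<^esub> p) w \<one>\<^bsub>M\<^esub>"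

definition satisfies :: "('a, 'm) monoid_scheme \<Rightarrow> identity \<Rightarrow> bool" where
  "satisfies M e \<longleftrightarrow>
     (\<forall>\<phi> \<in> UNIV \<rightarrow> carrier M. eval_word M \<phi> (fst e) = eval_word M \<phi> (snd e))"

definition models :: "identity set \<Rightarrow> 'u monoid set" where
  "models \<Sigma> = {M. monoid M \<and> (\<forall>e \<in> \<Sigma>. satisfies M e)}"


section \<open>Varieties of monoids\<close>

text \<open>
  A variety is a class of monoids closed under homomorphic images, submonoids and arbitrary
  direct products. Since HOL has no proper classes, monoids range over those whose carrier lies
  in a type \<open>'u\<close>, which is assumed infinite wherever varieties are used; a variety is determined
  by such members, already by the countable ones.

  A product of monoids over \<open>'u\<close> is in general too large for \<open>'u\<close>, so the three closure conditions
  are imposed in one step: every monoid over \<open>'u\<close> that is a homomorphic image of a submonoid of a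
  product of members is again a member. Index sets within \<open>'u\<close> are no restriction: a monoid
  over \<open>'u\<close> has at most \<open>|'u|\<close> generators, and in the relatively free monoid on that many
  generators there are at most \<open>|'u|\<close> pairs of distinct elements for the factors to separate.
\<close>

definition monoid_variety :: "'u monoid set \<Rightarrow> bool" where
  "monoid_variety W \<longleftrightarrow>
     (\<forall>M \<in> W. monoid M) \<and>
     (\<forall>(I :: 'u set) F S h N.
        F \<in> I \<rightarrow> W \<longrightarrow>
        submonoid S (product_group I F) \<longrightarrow>
        monoid N \<longrightarrow>
        h \<in> hom (product_group I F\<lparr>carrier := S\<rparr>) N \<longrightarrow>
        h \<one>\<^bsub>product_group I F\<^esub> = \<one>\<^bsub>N\<^esub> \<longrightarrow>
        h ` S = carrier N \<longrightarrow>
        N \<in> W)"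

text \<open>
  The least variety containing \<open>M\<close>. As \<open>M\<close> need not have its carrier in \<open>'u\<close>, containing it means
  containing its isomorphic copies over \<open>'u\<close> (such copies exist if \<open>M\<close> is countable and \<open>'u\<close> infinite).
\<close>

definition generated_variety :: "('a, 'm) monoid_scheme \<Rightarrow> 'u monoid set" where
  "generated_variety M =
     \<Inter> {W. monoid_variety W \<and> (\<forall>N :: 'u monoid. monoid N \<and> M \<cong> N \<longrightarrow> N \<in> W)}"


section \<open>The Brandt monoid\<close>

text \<open>
  The presentation is one of monoids with zero, so the zero is a third generator \<open>Gen0\<close>
  subject to the relations making it a zero.
\<close>

datatype brandt_gen = GenA | GenB | Gen0

inductive brandt_rel :: "brandt_gen list \<Rightarrow> brandt_gen list \<Rightarrow> bool" where
  "brandt_rel [GenA, GenB, GenA] [GenA]"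
| "brandt_rel [GenB, GenA, GenB] [GenB]"
| "brandt_rel [GenA, GenA] [Gen0]"
| "brandt_rel [GenB, GenB] [Gen0]"
| "brandt_rel [Gen0, g] [Gen0]"
| "brandt_rel [g, Gen0] [Gen0]"

inductive brandt_cong :: "brandt_gen list \<Rightarrow> brandt_gen list \<Rightarrow> bool" where
  rel: "brandt_rel u v \<Longrightarrow> brandt_cong (p @ u @ q) (p @ v @ q)"
| refl: "brandt_cong u u"
| sym: "brandt_cong u v \<Longrightarrow> brandt_cong v u"
| trans: "brandt_cong u v \<Longrightarrow> brandt_cong v w \<Longrightarrow> brandt_cong u w"

definition brandt_class :: "brandt_gen list \<Rightarrow> brandt_gen list set" where
  "brandt_class u = {v. brandt_cong u v}"

definition brandt_monoid :: "brandt_gen list set monoid" where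
  "brandt_monoid =
     \<lparr>carrier = range brandt_class,
      mult = (\<lambda>P Q. \<Union>u \<in> P. \<Union>v \<in> Q. brandt_class (u @ v)),
      one = brandt_class []\<rparr>"


section \<open>Zimin words\<close>

fun zimin :: "nat \<Rightarrow> word" where
  "zimin 0 = [0]"
| "zimin (Suc n) = zimin n @ [Suc n] @ zimin n"

text \<open>Position \<open>i\<close> of the limit word can be read off \<open>zimin i\<close>, whose length exceeds \<open>i\<close>.\<close>

definition zimin_inf :: "nat \<Rightarrow> nat" where
  "zimin_inf i = zimin i ! i"

definition factor_of_inf :: "word \<Rightarrow> (nat \<Rightarrow> nat) \<Rightarrow> bool" where
  "factor_of_inf w s \<longleftrightarrow> (\<exists>k. w = map s [k..<k + length w])"

datatype factor_elem = Zero | Factor word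

fun factor_mult :: "(nat \<Rightarrow> nat) \<Rightarrow> factor_elem \<Rightarrow> factor_elem \<Rightarrow> factor_elem" where
  "factor_mult s (Factor u) (Factor v) = (if factor_of_inf (u @ v) s then Factor (u @ v) else Zero)"
| "factor_mult s _ _ = Zero"

definition factor_carrier :: "(nat \<Rightarrow> nat) \<Rightarrow> factor_elem set" where
  "factor_carrier s = insert Zero (Factor ` {w. w \<noteq> [] \<and> factor_of_inf w s})"

text \<open>Adjoining a new identity element \<open>None\<close> to a semigroup given by carrier and product.\<close>

fun adjoin_one_mult :: "('a \<Rightarrow> 'a \<Rightarrow> 'a) \<Rightarrow> 'a option \<Rightarrow> 'a option \<Rightarrow> 'a option" where
  "adjoin_one_mult f None y = y"
| "adjoin_one_mult f x None = x"
| "adjoin_one_mult f (Some x) (Some y) = Some (f x y)"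

definition adjoin_one :: "'a set \<Rightarrow> ('a \<Rightarrow> 'a \<Rightarrow> 'a) \<Rightarrow> 'a option monoid" where
  "adjoin_one A f =
     \<lparr>carrier = insert None (Some ` A), mult = adjoin_one_mult f, one = None\<rparr>"

definition M_zimin :: "factor_elem option monoid" where
  "M_zimin = adjoin_one (factor_carrier zimin_inf) (factor_mult zimin_inf)"


section \<open>Consistency checks\<close>

lemma length_zimin_gt: "n < length (zimin n)"
  by (induction n) auto

lemma zimin_prefix: "m \<le> n \<Longrightarrow> i < length (zimin m) \<Longrightarrow> zimin n ! i = zimin m ! i"
proof (induction n rule: dec_induct)
  case (step n)
  have "length (zimin m) \<le> length (zimin n)"
    using step.hyps(1) by (induction rule: dec_induct) auto
  with step show ?case by (simp add: nth_append)
qed simp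

lemma zimin_inf_nth: "i < length (zimin n) \<Longrightarrow> zimin_inf i = zimin n ! i"
  unfolding zimin_inf_def using length_zimin_gt zimin_prefix by (metis nle_le)

lemma factor_of_inf_infix: "factor_of_inf (u @ v @ w) s \<Longrightarrow> factor_of_inf v s"
proof -
  assume "factor_of_inf (u @ v @ w) s"
  then obtain k where k: "u @ v @ w = map s [k..<k + length (u @ v @ w)]"
    unfolding factor_of_inf_def by blast
  have "v = map s [k + length u..<k + length u + length v]"
  proof (rule nth_equalityI)
    fix i assume i: "i < length v"
    have "v ! i = (u @ v @ w) ! (length u + i)" using i by (simp add: nth_append)
    also have "\<dots> = s (k + length u + i)" using i by (subst k) (simp add: add.assoc)
    finally show "v ! i = map s [k + length u..<k + length u + length v] ! i" using i by simp
  qed simp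
  then show ?thesis unfolding factor_of_inf_def by blast
qed

lemma factor_mult_assoc:
  "factor_mult s (factor_mult s x y) z = factor_mult s x (factor_mult s y z)"
proof (cases "\<exists>u v w. x = Factor u \<and> y = Factor v \<and> z = Factor w")
  case True
  then obtain u v w where "x = Factor u" "y = Factor v" "z = Factor w" by blast
  then show ?thesis
    using factor_of_inf_infix[of "[]" "u @ v" w s] factor_of_inf_infix[of u "v @ w" "[]" s] by simp
next
  case False
  then show ?thesis by (cases x; cases y; cases z; simp)
qed

lemma monoid_M_zimin: "monoid M_zimin"
proof (rule monoidI)
  fix x y z
  show "x \<otimes>\<^bsub>M_zimin\<^esub> y \<otimes>\<^bsub>M_zimin\<^esub> z = x \<otimes>\<^bsub>M_zimin\<^esub> (y \<otimes>\<^bsub>M_zimin\<^esub> z)"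
    by (cases x; cases y; cases z) (auto simp: M_zimin_def adjoin_one_def factor_mult_assoc)
  show "\<one>\<^bsub>M_zimin\<^esub> \<otimes>\<^bsub>M_zimin\<^esub> x = x" "x \<otimes>\<^bsub>M_zimin\<^esub> \<one>\<^bsub>M_zimin\<^esub> = x"
    by (cases x; simp add: M_zimin_def adjoin_one_def)+
qed (auto simp: M_zimin_def adjoin_one_def factor_carrier_def)

lemma brandt_cong_append:
  assumes "brandt_cong u u'" and "brandt_cong v v'"
  shows "brandt_cong (u @ v) (u' @ v')"
proof -
  have ctx: "brandt_cong (p @ x @ q) (p @ y @ q)" if "brandt_cong x y" for p q x y
    using that
  proof induction
    case (rel u v p' q')
    then show ?case using brandt_cong.rel[OF rel, of "p @ p'" "q' @ q"] by simp
  qed (auto intro: brandt_cong.intros)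
  show ?thesis
    using ctx[OF assms(1), of "[]" v] ctx[OF assms(2), of u' "[]"]
    by (metis append_Nil append_Nil2 brandt_cong.trans)
qed

lemma brandt_class_eq_iff: "brandt_class u = brandt_class v \<longleftrightarrow> brandt_cong u v"
proof
  assume "brandt_class u = brandt_class v"
  then have "v \<in> brandt_class u" by (simp add: brandt_class_def brandt_cong.refl)
  then show "brandt_cong u v" by (simp add: brandt_class_def)
next
  assume "brandt_cong u v"
  then show "brandt_class u = brandt_class v"
    unfolding brandt_class_def using brandt_cong.trans brandt_cong.sym by blast
qed

lemma brandt_class_mult:
  "brandt_class u \<otimes>\<^bsub>brandt_monoid\<^esub> brandt_class v = brandt_class (u @ v)"
proof -
  have "brandt_class (u' @ v') = brandt_class (u @ v)"
    if "u' \<in> brandt_class u" "v' \<in> brandt_class v" for u' v'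
    using that brandt_cong_append[of u u' v v'] brandt_cong.sym[of "u @ v" "u' @ v'"]
    unfolding brandt_class_eq_iff by (simp add: brandt_class_def)
  then have "(\<Union>u' \<in> brandt_class u. \<Union>v' \<in> brandt_class v. brandt_class (u' @ v')) =
      (\<Union>u' \<in> brandt_class u. \<Union>v' \<in> brandt_class v. brandt_class (u @ v))"
    by (intro SUP_cong HOL.refl)
  moreover have "u \<in> brandt_class u" "v \<in> brandt_class v"
    by (simp_all add: brandt_class_def brandt_cong.refl)
  then have "brandt_class u \<noteq> {}" "brandt_class v \<noteq> {}" by blast+
  ultimately show ?thesis unfolding brandt_monoid_def by simp
qed

lemma monoid_brandt: "monoid brandt_monoid"
proof -
  have 1: "\<one>\<^bsub>brandt_monoid\<^esub> = brandt_class []" and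
    c: "carrier brandt_monoid = range brandt_class"
    by (simp_all add: brandt_monoid_def)
  show ?thesis by (rule monoidI) (auto simp: 1 c brandt_class_mult)
qed

text \<open>
  Normal forms: the action of a word on \<open>{0, 1, 2}\<close> by partial injections, with \<open>0\<close> as the
  undefined value and \<open>a: 1 \<mapsto> 2\<close>, \<open>b: 2 \<mapsto> 1\<close>.
\<close>

fun brandt_act :: "brandt_gen list \<Rightarrow> nat \<Rightarrow> nat" where
  "brandt_act [] i = i"
| "brandt_act (GenA # w) i = brandt_act w (if i = 1 then 2 else 0)"
| "brandt_act (GenB # w) i = brandt_act w (if i = 2 then 1 else 0)"
| "brandt_act (Gen0 # w) i = brandt_act w 0"

lemma brandt_act_append: "brandt_act (u @ v) i = brandt_act v (brandt_act u i)"
  by (induction u i rule: brandt_act.induct) auto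

lemma brandt_act_0: "brandt_act w 0 = 0"
  by (induction w "0 :: nat" rule: brandt_act.induct) simp_all

lemma brandt_rel_act: "brandt_rel u v \<Longrightarrow> brandt_act u i = brandt_act v i"
proof (induction rule: brandt_rel.induct)
  case (5 g)
  show ?case by (cases g) (simp_all add: brandt_act_0)
next
  case (6 g)
  show ?case by (cases g) (simp_all add: brandt_act_0)
qed simp_all

lemma brandt_cong_act: "brandt_cong u v \<Longrightarrow> brandt_act u i = brandt_act v i"
  by (induction arbitrary: i rule: brandt_cong.induct) (simp_all add: brandt_act_append brandt_rel_act)

lemma brandt_normal_form:
  "\<exists>v \<in> {[], [GenA], [GenB], [GenA, GenB], [GenB, GenA], [Gen0]}. brandt_cong w v"
proof (induction w)
  case Nil
  show ?case by (simp add: brandt_cong.refl)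
next
  case (Cons g w)
  then obtain v where v: "v \<in> {[], [GenA], [GenB], [GenA, GenB], [GenB, GenA], [Gen0]}"
    and wv: "brandt_cong w v" by blast
  have "brandt_cong (g # w) (g # v)"
    using brandt_cong_append[OF brandt_cong.refl wv, of "[g]"] by simp
  moreover have "\<exists>v' \<in> {[], [GenA], [GenB], [GenA, GenB], [GenB, GenA], [Gen0]}.
      brandt_cong (g # v) v'"
  proof -
    have r: "brandt_cong (x @ y) (z @ y)" if "brandt_rel x z" for x y z
      using brandt_cong.rel[OF that, of "[]" y] by simp
    have 0: "brandt_cong [Gen0, x] [Gen0]" "brandt_cong [x, Gen0] [Gen0]" for x
      using r[of _ _ "[]"] by (auto intro: brandt_rel.intros)
    have 1: "brandt_cong [GenA, GenB, GenA] [GenA]" "brandt_cong [GenB, GenA, GenB] [GenB]"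
      "brandt_cong [GenA, GenA] [Gen0]" "brandt_cong [GenB, GenB] [Gen0]"
      using r[of _ _ "[]"] by (auto intro: brandt_rel.intros)
    have "brandt_cong [GenA, GenA, x] [Gen0, x]" "brandt_cong [GenB, GenB, x] [Gen0, x]"
      "brandt_cong [Gen0, y, x] [Gen0, x]" for x y
      using r[OF brandt_rel.intros(3), of "[x]"] r[OF brandt_rel.intros(4), of "[x]"]
        r[OF brandt_rel.intros(5), of y "[x]"] by simp_all
    then have 2: "brandt_cong [GenA, GenA, x] [Gen0]" "brandt_cong [GenB, GenB, x] [Gen0]"
      "brandt_cong [Gen0, y, x] [Gen0]" for x y
      using 0 brandt_cong.trans by blast+
    show ?thesis using v by (cases g) (auto simp: 0 1 2 brandt_cong.refl)
  qed
  ultimately show ?case using brandt_cong.trans by blast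
qed

lemma card_brandt: "card (carrier brandt_monoid) = 6"
proof -
  let ?N = "{[], [GenA], [GenB], [GenA, GenB], [GenB, GenA], [Gen0]}"
  have "carrier brandt_monoid = brandt_class ` ?N"
  proof
    show "carrier brandt_monoid \<subseteq> brandt_class ` ?N"
    proof
      fix P assume "P \<in> carrier brandt_monoid"
      then obtain w where "P = brandt_class w" by (auto simp: brandt_monoid_def)
      moreover obtain v where "v \<in> ?N" "brandt_cong w v" using brandt_normal_form by blast
      ultimately show "P \<in> brandt_class ` ?N" using brandt_class_eq_iff by blast
    qed
  qed (simp add: brandt_monoid_def image_mono)
  moreover have "inj_on brandt_class ?N"
  proof (rule inj_onI)
    fix u v assume uv: "u \<in> ?N" "v \<in> ?N" and "brandt_class u = brandt_class v"
    then have "brandt_act u 1 = brandt_act v 1" "brandt_act u 2 = brandt_act v 2"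
      by (simp_all add: brandt_class_eq_iff brandt_cong_act)
    then show "u = v" using uv by auto
  qed
  ultimately show ?thesis by (simp add: card_image)
qed

lemma monoid_variety_models: "monoid_variety (models \<Sigma>)"
  unfolding monoid_variety_def
proof (intro conjI allI impI ballI)
  fix M :: "'a monoid" assume "M \<in> models \<Sigma>"
  then show "monoid M" by (simp add: models_def)
next
  fix I :: "'a set" and F :: "'a \<Rightarrow> 'a monoid" and S h and N :: "'a monoid"
  let ?P = "product_group I F"
  assume F: "F \<in> I \<rightarrow> models \<Sigma>" and S: "submonoid S ?P" and N: "monoid N"
    and hom: "h \<in> hom (?P\<lparr>carrier := S\<rparr>) N" and h1: "h \<one>\<^bsub>?P\<^esub> = \<one>\<^bsub>N\<^esub>" and onto: "h ` S = carrier N"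
  have "satisfies N e" if e: "e \<in> \<Sigma>" for e
    unfolding satisfies_def
  proof
    fix \<phi> :: "nat \<Rightarrow> 'a" assume \<phi>: "\<phi> \<in> UNIV \<rightarrow> carrier N"
    have "\<forall>n. \<exists>x. x \<in> S \<and> h x = \<phi> n"
      using \<phi> onto by (metis PiE UNIV_I imageE)
    then obtain \<psi> where \<psi>: "\<And>n. \<psi> n \<in> S" "\<And>n. h (\<psi> n) = \<phi> n" by metis
    have in_S: "eval_word ?P \<psi> w \<in> S" for w
    proof (induction w)
      case Nil
      show ?case using submonoid.one_closed[OF S] by (simp add: eval_word_def del: one_product_group)
    next
      case (Cons n w)
      then show ?case
        using submonoid.m_closed[OF S \<psi>(1)]
        by (simp add: eval_word_def del: one_product_group mult_product_group)
    qed
    have hw: "h (eval_word ?P \<psi> w) = eval_word N \<phi> w" for w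
    proof (induction w)
      case Nil
      show ?case using h1 by (simp add: eval_word_def del: one_product_group)
    next
      case (Cons n w)
      have "h (\<psi> n \<otimes>\<^bsub>?P\<^esub> eval_word ?P \<psi> w) = h (\<psi> n) \<otimes>\<^bsub>N\<^esub> h (eval_word ?P \<psi> w)"
        using hom \<psi>(1) in_S by (simp add: hom_def del: mult_product_group)
      then show ?case
        using Cons \<psi>(2) by (simp add: eval_word_def del: one_product_group mult_product_group)
    qed
    have comp: "eval_word ?P \<psi> w = (\<lambda>i\<in>I. eval_word (F i) (\<lambda>n. \<psi> n i) w)" for w
      by (induction w) (auto simp: eval_word_def cong: restrict_cong)
    have "eval_word (F i) (\<lambda>n. \<psi> n i) (fst e) = eval_word (F i) (\<lambda>n. \<psi> n i) (snd e)"
      if i: "i \<in> I" for i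
    proof -
      have "satisfies (F i) e" using F i e by (auto simp: models_def)
      moreover have "(\<lambda>n. \<psi> n i) \<in> UNIV \<rightarrow> carrier (F i)"
        using \<psi>(1) submonoid.subset[OF S] i by (auto simp: PiE_iff subset_iff)
      ultimately show ?thesis unfolding satisfies_def by blast
    qed
    then have "eval_word ?P \<psi> (fst e) = eval_word ?P \<psi> (snd e)"
      unfolding comp by (intro restrict_ext)
    then show "eval_word N \<phi> (fst e) = eval_word N \<phi> (snd e)"
      by (metis hw)
  qed
  with N show "N \<in> models \<Sigma>" by (simp add: models_def)
qed

end

(*
  Idea. If w is an isoterm of the Brandt monoid B (no identity w = v with v other than w holds in B),
  then M(w), the monoid of factors of w with zero, lies in the variety generated by B. For odd n
  let c = c_n be the product of the words b_i b_j t over both orientations (i, j) of the edges of an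
  n-cycle, with a fresh letter t each time, and let w_n = a c_1 a c_2 a ... a c_N a. Both are isoterms
  of B, and the identity w_n = a a c fails in M(w_n). It holds in M(z_infinity): the images of w_n
  with a not erased would contain D_i D_j for all arcs (i, j), where D_i is the image of b_i a, and
  the 2-adic structure of the Zimin word makes the lengths of the nonempty words D_i divisible by
  every power of 2, because n is odd. On the other hand, an identity of M(z_infinity) with fewer than
  n letters holds in M(w_n): its repeated letters can only be mapped to factors of some a b_i a, so
  some b_m is avoided, and the cycle without the vertex m is bipartite, which lets the whole situation
  be pulled back to z_infinity. The second claim is immediate from this, and for the first one takes
  the independent identities given by n = 5, 25, 125, ...
*)
theory Submission
  imports Defs "HOL-Library.Sublist"
begin

section \<open>Varieties and identities\<close>

text \<open>The right side \<open>a a c\<close> merely expresses zero: words with a nonempty square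
  are not isoterms of B, so in the monoid of a factorial language of isoterms the identity
  \<open>w_n = a a c\<close> holds exactly when no substitution that keeps a sends
  \<open>w_n\<close> into the language. The cycles come from a property of the limit word:
  \<open>0 s 0 t 0\<close> with positive s, t is a factor exactly when one of s, t is 1 and the
  other is at least 2. Realising all blocks \<open>a b_i a b_j a\<close> letter by letter thus asks
  for a proper 2-colouring, which an odd cycle lacks and every path obtained by deleting a vertex
  has. Both orientations of each edge are needed because one arc relates start positions only;
  together with its reverse it relates the lengths of neighbouring \<open>D_i\<close>. The letters t
  serve the isoterm property of c, in which every \<open>b_i\<close> recurs: they let a two-state
  automaton be reset after each block. The constant 5: the n-th identity has at most 3n + 1 letters,
  hence passes to \<open>M(w_m)\<close> as soon as 3n + 1 < m for odd m, and 5 is the smallest odd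
  base greater than 1 whose powers are that far apart. In the opposite direction a comparison of
  lengths is enough.\<close>

definition identities :: "'u monoid set \<Rightarrow> identity set" where
  "identities W = {e. \<forall>M \<in> W. satisfies M e}"

lemma eval_word_simps [simp]:
  "eval_word M \<phi> [] = \<one>\<^bsub>M\<^esub>"
  "eval_word M \<phi> (x # w) = \<phi> x \<otimes>\<^bsub>M\<^esub> eval_word M \<phi> w"
  by (simp_all add: eval_word_def)

definition list_prod :: "('a, 'm) monoid_scheme \<Rightarrow> 'a list \<Rightarrow> 'a" where
  "list_prod M xs = foldr (mult M) xs \<one>\<^bsub>M\<^esub>"

lemma list_prod_simps [simp]:
  "list_prod M [] = \<one>\<^bsub>M\<^esub>"
  "list_prod M (x # xs) = x \<otimes>\<^bsub>M\<^esub> list_prod M xs"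
  by (simp_all add: list_prod_def)

lemma eval_word_list_prod: "eval_word M \<phi> w = list_prod M (map \<phi> w)"
  by (induction w) auto

lemma (in monoid) list_prod_closed: "set xs \<subseteq> carrier G \<Longrightarrow> list_prod G xs \<in> carrier G"
  by (induction xs) auto

lemma (in monoid) list_prod_append:
  "set xs \<subseteq> carrier G \<Longrightarrow> set ys \<subseteq> carrier G \<Longrightarrow>
    list_prod G (xs @ ys) = list_prod G xs \<otimes> list_prod G ys"
  by (induction xs) (auto simp: list_prod_closed m_assoc)

lemma (in monoid) eval_word_closed: "\<phi> \<in> UNIV \<rightarrow> carrier G \<Longrightarrow> eval_word G \<phi> w \<in> carrier G"
  by (induction w) auto

lemma (in monoid) eval_word_append:
  "\<phi> \<in> UNIV \<rightarrow> carrier G \<Longrightarrow> eval_word G \<phi> (u @ v) = eval_word G \<phi> u \<otimes> eval_word G \<phi> v"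
  by (induction u) (auto simp: eval_word_closed Pi_iff m_assoc)

lemma (in monoid) eval_word_subst:
  "\<phi> \<in> UNIV \<rightarrow> carrier G \<Longrightarrow>
    eval_word G \<phi> (concat (map g w)) = eval_word G (\<lambda>x. eval_word G \<phi> (g x)) w"
  by (induction w) (auto simp: eval_word_append)

lemma (in monoid) satisfies_subst:
  assumes "satisfies G (u, v)"
  shows "satisfies G (concat (map g u), concat (map g v))"
  using assms unfolding satisfies_def
  by (auto simp: eval_word_subst eval_word_closed Pi_iff)

text \<open>Only finitely many letters occur, so words over any alphabet can be renamed into words
  over the naturals, and \<open>inv_into\<close> undoes the renaming in the assignment. Birkhoff's
  argument uses the elements of \<open>'u\<close> themselves as letters.\<close>

lemma satisfies_list_prod:
  fixes u v :: "'x list"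
  assumes "satisfies M (map (e :: 'x \<Rightarrow> nat) u, map e v)" and "inj_on e (set u \<union> set v)"
    and "\<phi> \<in> UNIV \<rightarrow> carrier M"
  shows "list_prod M (map \<phi> u) = list_prod M (map \<phi> v)"
proof -
  define d where "d = \<phi> \<circ> inv_into (set u \<union> set v) e"
  have "d \<in> UNIV \<rightarrow> carrier M" using assms(3) by (auto simp: d_def)
  then have "eval_word M d (map e u) = eval_word M d (map e v)"
    using assms(1) by (auto simp: satisfies_def)
  moreover have "map d (map e u) = map \<phi> u" "map d (map e v) = map \<phi> v"
    using assms(2) by (auto simp: d_def)
  ultimately show ?thesis by (simp add: eval_word_list_prod del: map_map)
qed

section \<open>Birkhoff's theorem and transfer between carrier types\<close>

lemma infinite_imp_list_pair_inj:
  assumes "infinite (UNIV :: 'u set)"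
  shows "\<exists>f :: 'u list \<times> 'u list \<Rightarrow> 'u. inj f"
proof -
  have "\<exists>p :: 'u \<times> 'u \<Rightarrow> 'u. bij_betw p (UNIV \<times> UNIV) UNIV"
    using card_of_Times_same_infinite[OF assms] unfolding card_of_ordIso[symmetric] .
  then obtain p :: "'u \<times> 'u \<Rightarrow> 'u" where "inj p"
    by (metis UNIV_Times_UNIV bij_betw_imp_inj_on)
  then have p: "p a = p b \<longleftrightarrow> a = b" for a b by (simp add: inj_eq)
  obtain q :: "nat \<Rightarrow> 'u" where "inj q"
    using infinite_countable_subset[OF assms(1)] by auto
  then have q: "q a = q b \<longleftrightarrow> a = b" for a b by (simp add: inj_eq)
  define enc where "enc = rec_list (q 0) (\<lambda>x _ r. p (x, r))"
  have enc_simps: "enc (x # xs) = p (x, enc xs)" for x xs by (simp add: enc_def)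
  have enc: "length xs = length ys \<Longrightarrow> enc xs = enc ys \<Longrightarrow> xs = ys" for xs ys
  proof (induction xs arbitrary: ys)
    case (Cons x xs)
    then obtain y ys' where "ys = y # ys'" by (cases ys) auto
    with Cons show ?case by (auto simp: enc_simps p)
  qed simp
  \<comment> \<open>\<open>enc\<close> is injective only among lists of equal length, since the end
    marker \<open>q 0\<close> may also be a value of \<open>p\<close>. Hence the length is stored as
    well.\<close>
  define f where "f = (\<lambda>xs. p (q (length xs), enc xs))"
  have f: "f xs = f ys \<longleftrightarrow> xs = ys" for xs ys
    unfolding f_def p prod.inject q using enc by blast
  have "inj (\<lambda>(xs, ys). p (f xs, f ys))"
    by (rule injI) (auto simp: p f)
  then show ?thesis by blast
qed

text \<open>Birkhoff's theorem. \<open>S\<close> is the relatively free monoid of \<open>W\<close>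
  on the elements of \<open>'u\<close>: one factor of the product is spent on each pair of words
  that some member of \<open>W\<close> separates. \<open>N\<close> is the image of \<open>S\<close>
  under the map sending \<open>\<gamma> x\<close> to \<open>x\<close> for \<open>x\<close> in
  \<open>N\<close>. Since pairs of words over \<open>'u\<close> embed into \<open>'u\<close>, the
  index set stays within the type.\<close>

theorem monoid_variety_eq_models:
  fixes W :: "'u monoid set"
  assumes inf: "infinite (UNIV :: 'u set)" and W: "monoid_variety W"
  shows "W = models (identities W)"
proof
  show "W \<subseteq> models (identities W)"
    using W by (auto simp: monoid_variety_def models_def identities_def)
  show "models (identities W) \<subseteq> W"
  proof
    fix N :: "'u monoid" assume "N \<in> models (identities W)"
    then have N: "monoid N" and Nsat: "\<And>e. e \<in> identities W \<Longrightarrow> satisfies N e"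
      by (auto simp: models_def)
    interpret N: monoid N by (rule N)
    obtain \<iota> :: "'u list \<times> 'u list \<Rightarrow> 'u" where \<iota>: "inj \<iota>"
      using infinite_imp_list_pair_inj[OF inf] by blast
    define \<kappa> where "\<kappa> = inv_into UNIV \<iota>"
    have \<kappa>: "\<kappa> (\<iota> e) = e" for e using \<iota> by (simp add: \<kappa>_def)
    define sep where "sep = (\<lambda>e (M :: 'u monoid) \<phi>. M \<in> W \<and> (\<forall>x :: 'u. \<phi> x \<in> carrier M) \<and>
      list_prod M (map \<phi> (fst e)) \<noteq> list_prod M (map \<phi> (snd e)))"
    define K where "K = {e. \<exists>M \<phi>. sep e M \<phi>}"
    have "\<forall>e. \<exists>M \<phi>. e \<in> K \<longrightarrow> sep e M \<phi>" by (auto simp: K_def)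
    then obtain FM \<Phi> where sep: "\<And>e. e \<in> K \<Longrightarrow> sep e (FM e) (\<Phi> e)" by metis
    then have sep: "FM e \<in> W" "\<Phi> e x \<in> carrier (FM e)"
      "list_prod (FM e) (map (\<Phi> e) (fst e)) \<noteq> list_prod (FM e) (map (\<Phi> e) (snd e))"
      if "e \<in> K" for e x
      using that by (auto simp: sep_def)
    define I where "I = \<iota> ` K"
    define F where "F = FM \<circ> \<kappa>"
    define \<gamma> where "\<gamma> = (\<lambda>x. \<lambda>i\<in>I. \<Phi> (\<kappa> i) x)"
    let ?P = "product_group I F"
    have F: "F \<in> I \<rightarrow> W"
      by (auto simp: I_def F_def \<kappa> sep)
    have Fmon: "monoid (F i)" if "i \<in> I" for i
      using F W that by (auto simp: monoid_variety_def)
    have \<gamma>: "\<gamma> x \<in> carrier ?P" for x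
      by (auto simp: \<gamma>_def I_def F_def \<kappa> sep)
    have comp: "list_prod ?P (map \<gamma> u) = (\<lambda>i\<in>I. list_prod (F i) (map (\<Phi> (\<kappa> i)) u))" for u
      by (induction u) (auto simp: \<gamma>_def cong: restrict_cong)
    define S where "S = range (\<lambda>u. list_prod ?P (map \<gamma> u))"
    \<comment> \<open>Letters outside the carrier of \<open>N\<close> get the identity element as
      default value.\<close>
    define \<nu> where "\<nu> = (\<lambda>x. if x \<in> carrier N then x else \<one>\<^bsub>N\<^esub>)"
    have \<nu>: "\<nu> x \<in> carrier N" for x by (simp add: \<nu>_def)
    define h where "h = (\<lambda>s. list_prod N (map \<nu> (SOME u. s = list_prod ?P (map \<gamma> u))))"
    \<comment> \<open>This makes \<open>h\<close> independent of the word picked by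
      \<open>SOME\<close>: two words with equal value in the product are separated by no member of
      \<open>W\<close>, so they form an identity of \<open>W\<close> and therefore of
      \<open>N\<close>.\<close>
    have sat: "list_prod N (map \<nu> u) = list_prod N (map \<nu> v)"
      if eq: "list_prod ?P (map \<gamma> u) = list_prod ?P (map \<gamma> v)" for u v
    proof -
      have "(u, v) \<notin> K"
      proof
        assume uv: "(u, v) \<in> K"
        then have "\<iota> (u, v) \<in> I" by (simp add: I_def)
        then have "list_prod (FM (u, v)) (map (\<Phi> (u, v)) u) = list_prod (FM (u, v)) (map (\<Phi> (u, v)) v)"
          using fun_cong[OF eq[unfolded comp], of "\<iota> (u, v)"] by (simp add: F_def \<kappa>)
        then show False using sep(3)[OF uv] by simp
      qed
      then have all: "list_prod M (map \<phi> u) = list_prod M (map \<phi> v)"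
        if "M \<in> W" "\<phi> \<in> UNIV \<rightarrow> carrier M" for M \<phi>
        using that by (auto simp: K_def sep_def)
      obtain e :: "'u \<Rightarrow> nat" where e: "inj_on e (set u \<union> set v)"
        using finite_imp_inj_to_nat_seg[of "set u \<union> set v"] by auto
      have "(map e u, map e v) \<in> identities W"
        unfolding identities_def satisfies_def
        by (auto simp: eval_word_list_prod intro!: all)
      from satisfies_list_prod[OF Nsat[OF this] e, of \<nu>] show ?thesis using \<nu> by auto
    qed
    have h: "h (list_prod ?P (map \<gamma> u)) = list_prod N (map \<nu> u)" for u
      unfolding h_def by (rule sat, rule someI2[where a = u]) auto
    have \<Phi>: "\<Phi> (\<kappa> i) x \<in> carrier (F i)" if "i \<in> I" for i x
      using that by (auto simp: I_def F_def \<kappa> sep)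
    have mP: "list_prod ?P (map \<gamma> u) \<otimes>\<^bsub>?P\<^esub> list_prod ?P (map \<gamma> v) = list_prod ?P (map \<gamma> (u @ v))" for u v
    proof -
      have "list_prod (F i) (map (\<Phi> (\<kappa> i)) u) \<otimes>\<^bsub>F i\<^esub> list_prod (F i) (map (\<Phi> (\<kappa> i)) v) =
          list_prod (F i) (map (\<Phi> (\<kappa> i)) (u @ v))" if "i \<in> I" for i
        using monoid.list_prod_append[OF Fmon[OF that], of "map (\<Phi> (\<kappa> i)) u" "map (\<Phi> (\<kappa> i)) v"]
          \<Phi>[OF that] by (force simp: image_subset_iff)
      then show ?thesis unfolding comp by (auto intro!: restrict_ext)
    qed
    have mN: "list_prod N (map \<nu> (u @ v)) = list_prod N (map \<nu> u) \<otimes>\<^bsub>N\<^esub> list_prod N (map \<nu> v)" for u v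
      using \<nu> by (auto intro!: N.list_prod_append)
    have cS: "S \<subseteq> carrier ?P"
    proof -
      have "list_prod (F i) (map (\<Phi> (\<kappa> i)) u) \<in> carrier (F i)" if "i \<in> I" for i u
        by (rule monoid.list_prod_closed[OF Fmon[OF that]]) (use \<Phi>[OF that] in auto)
      then show ?thesis by (auto simp: S_def comp)
    qed
    have mS: "mult (?P\<lparr>carrier := S\<rparr>) = mult ?P" by simp
    have oP: "\<one>\<^bsub>?P\<^esub> = list_prod ?P (map \<gamma> [])" by simp
    have "submonoid S ?P"
    proof
      show "x \<otimes>\<^bsub>?P\<^esub> y \<in> S" if "x \<in> S" "y \<in> S" for x y
      proof -
        obtain u v where "x = list_prod ?P (map \<gamma> u)" "y = list_prod ?P (map \<gamma> v)"
          using \<open>x \<in> S\<close> \<open>y \<in> S\<close> unfolding S_def by blast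
        then have "x \<otimes>\<^bsub>?P\<^esub> y = list_prod ?P (map \<gamma> (u @ v))" by (simp only: mP)
        then show ?thesis unfolding S_def by blast
      qed
      show "\<one>\<^bsub>?P\<^esub> \<in> S" unfolding S_def oP by blast
    qed (fact cS)
    moreover have "h \<in> hom (?P\<lparr>carrier := S\<rparr>) N"
    proof (rule homI)
      fix x y
      assume "x \<in> carrier (?P\<lparr>carrier := S\<rparr>)" "y \<in> carrier (?P\<lparr>carrier := S\<rparr>)"
      then obtain u v where "x = list_prod ?P (map \<gamma> u)" "y = list_prod ?P (map \<gamma> v)"
        by (auto simp: S_def)
      then show "h (x \<otimes>\<^bsub>?P\<lparr>carrier := S\<rparr>\<^esub> y) = h x \<otimes>\<^bsub>N\<^esub> h y"
        by (simp only: mS mP mN h)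
    next
      fix x assume "x \<in> carrier (?P\<lparr>carrier := S\<rparr>)"
      then show "h x \<in> carrier N"
        using h \<nu> by (auto simp: S_def intro!: N.list_prod_closed)
    qed
    moreover have "h \<one>\<^bsub>?P\<^esub> = \<one>\<^bsub>N\<^esub>" unfolding oP h by simp
    moreover have "h ` S = carrier N"
    proof
      show "h ` S \<subseteq> carrier N" using h \<nu> by (auto simp: S_def intro!: N.list_prod_closed)
      show "carrier N \<subseteq> h ` S"
      proof
        fix x assume x: "x \<in> carrier N"
        then have "x = h (list_prod ?P (map \<gamma> [x]))" unfolding h by (simp add: \<nu>_def)
        then show "x \<in> h ` S" unfolding S_def by blast
      qed
    qed
    ultimately show "N \<in> W" using W F N unfolding monoid_variety_def by blast
  qed
qed

lemma hom_eval_word: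
  assumes "h \<in> hom M N" "monoid M" "h \<one>\<^bsub>M\<^esub> = \<one>\<^bsub>N\<^esub>" "\<phi> \<in> UNIV \<rightarrow> carrier M"
  shows "h (eval_word M \<phi> w) = eval_word N (h \<circ> \<phi>) w"
proof (induction w)
  case (Cons x w)
  have "eval_word M \<phi> w \<in> carrier M" "\<phi> x \<in> carrier M"
    using assms by (auto simp: monoid.eval_word_closed)
  then show ?case using Cons hom_mult[OF assms(1)] by simp
qed (simp add: assms)

lemma iso_satisfies_iff:
  assumes "M \<cong> N" "monoid M" "monoid N"
  shows "satisfies M e \<longleftrightarrow> satisfies N e"
proof -
  interpret M: monoid M by fact
  interpret N: monoid N by fact
  obtain h where h: "h \<in> hom M N" and bij: "bij_betw h (carrier M) (carrier N)"
    using assms(1) by (auto simp: is_iso_def iso_def)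
  \<comment> \<open>\<open>hom\<close> preserves products only; the unit is handled by
    surjectivity.\<close>
  have h1: "h \<one>\<^bsub>M\<^esub> = \<one>\<^bsub>N\<^esub>"
  proof -
    obtain y where y: "y \<in> carrier M" "h y = \<one>\<^bsub>N\<^esub>"
      using bij by (metis N.one_closed bij_betw_iff_bijections)
    have "h (\<one>\<^bsub>M\<^esub> \<otimes>\<^bsub>M\<^esub> y) = h \<one>\<^bsub>M\<^esub> \<otimes>\<^bsub>N\<^esub> \<one>\<^bsub>N\<^esub>"
      using hom_mult[OF h M.one_closed y(1)] y by simp
    then show ?thesis using y hom_in_carrier[OF h M.one_closed] by simp
  qed
  note ev = hom_eval_word[OF h assms(2) h1]
  have inj: "inj_on h (carrier M)" using bij by (simp add: bij_betw_def)
  show ?thesis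
  proof
    assume s: "satisfies M e"
    show "satisfies N e" unfolding satisfies_def
    proof
      fix \<phi> :: "nat \<Rightarrow> _" assume \<phi>: "\<phi> \<in> UNIV \<rightarrow> carrier N"
      define \<psi> where "\<psi> = inv_into (carrier M) h \<circ> \<phi>"
      have \<psi>: "\<psi> \<in> UNIV \<rightarrow> carrier M" "h \<circ> \<psi> = \<phi>"
        using \<phi> bij unfolding \<psi>_def
        by (auto simp: bij_betw_def fun_eq_iff Pi_iff intro!: inv_into_into f_inv_into_f)
      then show "eval_word N \<phi> (fst e) = eval_word N \<phi> (snd e)"
        using s ev[OF \<psi>(1)] by (metis satisfies_def)
    qed
  next
    assume s: "satisfies N e"
    show "satisfies M e" unfolding satisfies_def
    proof
      fix \<phi> :: "nat \<Rightarrow> _" assume \<phi>: "\<phi> \<in> UNIV \<rightarrow> carrier M"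
      have "h \<circ> \<phi> \<in> UNIV \<rightarrow> carrier N" using \<phi> hom_in_carrier[OF h] by (auto simp: Pi_iff)
      then have "h (eval_word M \<phi> (fst e)) = h (eval_word M \<phi> (snd e))"
        using s ev[OF \<phi>] by (metis satisfies_def)
      then show "eval_word M \<phi> (fst e) = eval_word M \<phi> (snd e)"
        by (rule inj_onD[OF inj]) (simp_all add: M.eval_word_closed[OF \<phi>])
    qed
  qed
qed

lemma countable_monoid_copy:
  assumes "infinite (UNIV :: 'u set)" "monoid M" "countable (carrier M)"
  shows "\<exists>N :: 'u monoid. monoid N \<and> M \<cong> N"
proof -
  interpret M: monoid M by fact
  obtain q :: "nat \<Rightarrow> 'u" where q: "inj q"
    using infinite_countable_subset[OF assms(1)] by auto
  define f where "f = q \<circ> to_nat_on (carrier M)"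
  have f: "inj_on f (carrier M)"
    unfolding f_def using assms(3) q by (meson comp_inj_on inj_on_subset inj_on_to_nat_on subset_UNIV)
  let ?i = "inv_into (carrier M) f"
  define N :: "'u monoid" where "N = \<lparr>carrier = f ` carrier M,
    mult = (\<lambda>x y. f (?i x \<otimes>\<^bsub>M\<^esub> ?i y)), one = f \<one>\<^bsub>M\<^esub>\<rparr>"
  have "monoid N"
    by (rule monoidI) (auto simp: N_def f M.m_assoc)
  moreover have "f \<in> iso M N"
    using f by (auto simp: iso_def hom_def N_def bij_betw_def)
  ultimately show ?thesis by (auto simp: is_iso_def)
qed

lemma monoid_variety_generated: "monoid_variety (generated_variety M :: 'u monoid set)"
  unfolding monoid_variety_def
proof (intro conjI allI impI ballI)
  fix N :: "'u monoid" assume "N \<in> generated_variety M"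
  \<comment> \<open>The class of all monoids belongs to the intersected family, which is therefore
    not empty.\<close>
  moreover have "monoid_variety (models {} :: 'u monoid set)" by (rule monoid_variety_models)
  moreover have "\<forall>N :: 'u monoid. monoid N \<and> M \<cong> N \<longrightarrow> N \<in> models {}" by (simp add: models_def)
  ultimately have "N \<in> models {}" unfolding generated_variety_def by blast
  then show "monoid N" by (simp add: models_def)
next
  fix I :: "'u set" and F :: "'u \<Rightarrow> 'u monoid" and S h and N :: "'u monoid"
  let ?P = "product_group I F"
  assume a: "F \<in> I \<rightarrow> generated_variety M" "submonoid S ?P" "monoid N"
    "h \<in> hom (?P\<lparr>carrier := S\<rparr>) N" "h \<one>\<^bsub>?P\<^esub> = \<one>\<^bsub>N\<^esub>" "h ` S = carrier N"
  show "N \<in> generated_variety M"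
    unfolding generated_variety_def
  proof (rule InterI)
    fix W :: "'u monoid set"
    assume W: "W \<in> {W. monoid_variety W \<and> (\<forall>N. monoid N \<and> M \<cong> N \<longrightarrow> N \<in> W)}"
    then have "generated_variety M \<subseteq> W" unfolding generated_variety_def by blast
    then have "F \<in> I \<rightarrow> W" using a(1) by blast
    then show "N \<in> W" using W a unfolding monoid_variety_def by blast
  qed
qed

lemma copy_in_generated_variety:
  "monoid N \<Longrightarrow> M \<cong> N \<Longrightarrow> N \<in> generated_variety M"
  unfolding generated_variety_def by blast

lemma generated_variety_subset_models:
  assumes "monoid M" "\<And>e. e \<in> \<Sigma> \<Longrightarrow> satisfies M e"
  shows "generated_variety M \<subseteq> models \<Sigma>"
proof -
  have "N \<in> models \<Sigma>" if "monoid N" "M \<cong> N" for N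
    using that assms iso_satisfies_iff[OF that(2) assms(1) that(1)] by (auto simp: models_def)
  then show ?thesis
    unfolding generated_variety_def using monoid_variety_models by blast
qed

text \<open>Countability provides a copy of \<open>M\<close> over \<open>'u\<close>. This copy is a
  member of the generated variety, so every identity of that variety is one of \<open>M\<close>, and
  Birkhoff's theorem turns this into the inclusion.\<close>

lemma models_subset_generated_variety:
  fixes M :: "('a, 'm) monoid_scheme"
  assumes "infinite (UNIV :: 'u set)" "monoid M" "countable (carrier M)"
  shows "(models {e. satisfies M e} :: 'u monoid set) \<subseteq> generated_variety M"
proof -
  let ?G = "generated_variety M :: 'u monoid set"
  obtain N :: "'u monoid" where N: "monoid N" "M \<cong> N"
    using countable_monoid_copy[OF assms] by blast
  have "identities ?G \<subseteq> {e. satisfies M e}"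
    using copy_in_generated_variety[OF N] iso_satisfies_iff[OF N(2) assms(2) N(1)]
    by (auto simp: identities_def)
  then have "(models {e. satisfies M e} :: 'u monoid set) \<subseteq> models (identities ?G)"
    by (auto simp: models_def)
  then show ?thesis
    using monoid_variety_eq_models[OF assms(1) monoid_variety_generated] by blast
qed


section \<open>Isoterms of the Brandt monoid\<close>

fun word_mult :: "word set \<Rightarrow> factor_elem \<Rightarrow> factor_elem \<Rightarrow> factor_elem" where
  "word_mult L (Factor u) (Factor v) = (if u @ v \<in> L then Factor (u @ v) else Zero)"
| "word_mult L _ _ = Zero"

definition word_monoid :: "word set \<Rightarrow> factor_elem option monoid" where
  "word_monoid L = adjoin_one (insert Zero (Factor ` {w \<in> L. w \<noteq> []})) (word_mult L)"

text \<open>The homomorphism from the free monoid that sends the complement of \<open>L\<close> to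
  zero. Writing elements in this way turns evaluation into substitution of words.\<close>

definition word_elem :: "word set \<Rightarrow> word \<Rightarrow> factor_elem option" where
  "word_elem L w = (if w = [] then None else if w \<in> L then Some (Factor w) else Some Zero)"

text \<open>\<open>proper\<close> supplies a word that becomes \<open>Zero\<close>, so that
  \<open>word_elem\<close> reaches the whole carrier.\<close>

locale factorial_language =
  fixes L :: "word set"
  assumes sublist_closed: "w \<in> L \<Longrightarrow> sublist u w \<Longrightarrow> u \<in> L"
    and Nil_mem: "[] \<in> L"
    and proper: "L \<noteq> UNIV"
begin

lemma append_memD: "u @ v \<in> L \<Longrightarrow> u \<in> L" "u @ v \<in> L \<Longrightarrow> v \<in> L"
  by (erule sublist_closed, simp)+

lemma word_elem_mult: "word_elem L u \<otimes>\<^bsub>word_monoid L\<^esub> word_elem L v = word_elem L (u @ v)"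
  by (auto simp: word_elem_def word_monoid_def adjoin_one_def dest: append_memD)

lemma carrier_word_monoid: "carrier (word_monoid L) = range (word_elem L)"
proof -
  obtain z where z: "z \<notin> L" using proper by auto
  then have "Some Zero = word_elem L z" using Nil_mem by (auto simp: word_elem_def)
  moreover have "None = word_elem L []" by (simp add: word_elem_def)
  moreover have "Some (Factor w) = word_elem L w" if "w \<in> L" "w \<noteq> []" for w
    using that by (simp add: word_elem_def)
  ultimately have "carrier (word_monoid L) \<subseteq> range (word_elem L)"
    by (auto simp: word_monoid_def adjoin_one_def)
  then show ?thesis
    by (auto simp: word_monoid_def adjoin_one_def word_elem_def)
qed

lemma one_word_monoid: "\<one>\<^bsub>word_monoid L\<^esub> = word_elem L []"
  by (simp add: word_elem_def word_monoid_def adjoin_one_def)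

lemma monoid_word_monoid: "monoid (word_monoid L)"
  by (rule monoidI) (auto simp: carrier_word_monoid one_word_monoid word_elem_mult)

lemma countable_word_monoid: "countable (carrier (word_monoid L))"
  unfolding carrier_word_monoid by simp

lemma eval_word_elem: "eval_word (word_monoid L) (\<lambda>x. word_elem L (g x)) w = word_elem L (concat (map g w))"
  by (induction w) (simp_all add: one_word_monoid word_elem_mult)

lemma word_elem_eq_iff: "word_elem L u = word_elem L v \<longleftrightarrow> (u \<in> L \<or> v \<in> L \<longrightarrow> u = v)"
  using Nil_mem by (auto simp: word_elem_def)

text \<open>Every assignment is a substitution of words followed by \<open>word_elem\<close>, which
  is injective on \<open>L\<close> and constant outside it. Later arguments about these monoids only
  speak of substitutions.\<close>

lemma satisfies_word_monoid:
  "satisfies (word_monoid L) (u, v) \<longleftrightarrow>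
    (\<forall>g. concat (map g u) \<in> L \<or> concat (map g v) \<in> L \<longrightarrow> concat (map g u) = concat (map g v))"
proof
  assume s: "satisfies (word_monoid L) (u, v)"
  show "\<forall>g. concat (map g u) \<in> L \<or> concat (map g v) \<in> L \<longrightarrow> concat (map g u) = concat (map g v)"
  proof
    fix g :: "nat \<Rightarrow> word"
    have "(\<lambda>x. word_elem L (g x)) \<in> UNIV \<rightarrow> carrier (word_monoid L)"
      by (simp add: carrier_word_monoid)
    then show "concat (map g u) \<in> L \<or> concat (map g v) \<in> L \<longrightarrow> concat (map g u) = concat (map g v)"
      using s by (force simp: satisfies_def eval_word_elem word_elem_eq_iff)
  qed
next
  assume r: "\<forall>g. concat (map g u) \<in> L \<or> concat (map g v) \<in> L \<longrightarrow> concat (map g u) = concat (map g v)"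
  show "satisfies (word_monoid L) (u, v)"
    unfolding satisfies_def
  proof
    fix \<phi> :: "nat \<Rightarrow> _" assume "\<phi> \<in> UNIV \<rightarrow> carrier (word_monoid L)"
    then have "\<forall>x. \<exists>w. \<phi> x = word_elem L w" by (auto simp: carrier_word_monoid Pi_iff)
    then obtain g where "\<And>x. \<phi> x = word_elem L (g x)" by metis
    then have \<phi>: "\<phi> = (\<lambda>x. word_elem L (g x))" by (rule ext)
    show "eval_word (word_monoid L) \<phi> (fst (u, v)) = eval_word (word_monoid L) \<phi> (snd (u, v))"
      unfolding \<phi> fst_conv snd_conv eval_word_elem word_elem_eq_iff using r by blast
  qed
qed

end

definition isoterm :: "('a, 'm) monoid_scheme \<Rightarrow> word \<Rightarrow> bool" where
  "isoterm M w \<longleftrightarrow> (\<forall>v. satisfies M (w, v) \<longrightarrow> v = w)"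

lemma satisfies_sym: "satisfies M (u, v) \<longleftrightarrow> satisfies M (v, u)"
  by (auto simp: satisfies_def)

text \<open>Substitution instances of an identity of \<open>M\<close> hold in \<open>M\<close>; when
  one side of an instance is an isoterm, the other side must be the same word.\<close>

lemma (in factorial_language) satisfies_word_monoid_of_isoterms:
  assumes "monoid M" "L \<subseteq> Collect (isoterm M)" "satisfies M (u, v)"
  shows "satisfies (word_monoid L) (u, v)"
proof -
  have "concat (map g u) = concat (map g v)"
    if "concat (map g u) \<in> L \<or> concat (map g v) \<in> L" for g :: "nat \<Rightarrow> word"
    using that assms(2) monoid.satisfies_subst[OF assms(1,3), of g]
    by (metis satisfies_sym isoterm_def mem_Collect_eq subsetD)
  then show ?thesis by (auto simp: satisfies_word_monoid)
qed

lemma (in monoid) satisfies_context: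
  assumes "satisfies G (u, v)"
  shows "satisfies G (p @ u @ q, p @ v @ q)"
  using assms by (auto simp: satisfies_def eval_word_append eval_word_closed)

lemma isoterm_sublist:
  assumes "monoid M" "isoterm M w" "sublist u w"
  shows "isoterm M u"
proof -
  obtain p q where w: "w = p @ u @ q" using assms(3) by (auto simp: sublist_def)
  have "v = u" if "satisfies M (u, v)" for v
    using monoid.satisfies_context[OF assms(1) that, of p q] assms(2) w by (auto simp: isoterm_def)
  then show ?thesis by (simp add: isoterm_def)
qed

lemma isoterm_square_free:
  assumes "monoid M" "satisfies M ([0, 0], [0, 0, 0])" "isoterm M w" "sublist (u @ u) w"
  shows "u = []"
proof -
  have "satisfies M (u @ u, u @ u @ u)"
    using monoid.satisfies_subst[OF assms(1,2), of "\<lambda>_. u"] by simp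
  then show ?thesis using isoterm_sublist[OF assms(1,3,4)] by (auto simp: isoterm_def)
qed

text \<open>The projections to the pair formed by the two first letters begin with these letters, so
  the first letters agree and can be cut off.\<close>

lemma filter_pairs_eqI:
  assumes "\<And>x y. x \<in> set u \<union> set v \<Longrightarrow> y \<in> set u \<union> set v \<Longrightarrow>
    filter (\<lambda>z. z = x \<or> z = y) u = filter (\<lambda>z. z = x \<or> z = y) v"
  shows "u = v"
  using assms
proof (induction u arbitrary: v)
  case Nil
  then show ?case by (cases v) fastforce+
next
  case (Cons a u)
  show ?case
  proof (cases v)
    case Nil
    then show ?thesis using Cons.prems[of a a] by simp
  next
    case (Cons b v')
    have ab: "a = b" using Cons.prems[of a b] Cons by (auto split: if_splits)
    have "u = v'"
    proof (rule Cons.IH)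
      fix x y assume "x \<in> set u \<union> set v'" "y \<in> set u \<union> set v'"
      then show "filter (\<lambda>z. z = x \<or> z = y) u = filter (\<lambda>z. z = x \<or> z = y) v'"
        using Cons.prems[of x y] Cons ab by (auto split: if_splits)
    qed
    then show ?thesis using ab Cons by simp
  qed
qed

section \<open>Identities of the Brandt monoid seen through two-state runs\<close>

text \<open>
  A letter mapped to \<open>Some (p, q)\<close> acts as the partial bijection \<open>p \<mapsto> q\<close>, a letter mapped to
  \<open>None\<close> is erased.
\<close>

fun run :: "('x \<Rightarrow> (bool \<times> bool) option) \<Rightarrow> 'x list \<Rightarrow> bool \<Rightarrow> bool option" where
  "run \<psi> [] s = Some s"
| "run \<psi> (x # w) s = (case \<psi> x of None \<Rightarrow> run \<psi> w s
     | Some (p, q) \<Rightarrow> if p = s then run \<psi> w q else None)"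

lemma run_append: "run \<psi> (u @ v) s = Option.bind (run \<psi> u s) (run \<psi> v)"
  by (induction u arbitrary: s) (auto split: option.splits)

text \<open>The states \<open>False\<close> and \<open>True\<close> are the points 1 and 2 moved by
  \<open>brandt_act\<close>; the two loops are the idempotents \<open>ab\<close> and
  \<open>ba\<close>.\<close>

fun brandt_word :: "(bool \<times> bool) option \<Rightarrow> brandt_gen list" where
  "brandt_word None = []"
| "brandt_word (Some (False, True)) = [GenA]"
| "brandt_word (Some (True, False)) = [GenB]"
| "brandt_word (Some (False, False)) = [GenA, GenB]"
| "brandt_word (Some (True, True)) = [GenB, GenA]"

fun brandt_state :: "bool option \<Rightarrow> nat" where
  "brandt_state None = 0"
| "brandt_state (Some False) = 1"
| "brandt_state (Some True) = 2"

lemma brandt_act_run: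
  "brandt_act (concat (map (brandt_word \<circ> \<psi>) w)) (brandt_state (Some s)) = brandt_state (run \<psi> w s)"
proof (induction w arbitrary: s)
  case (Cons x w)
  show ?case
  proof (cases "\<psi> x")
    case None
    then show ?thesis using Cons by simp
  next
    case (Some pq)
    then show ?thesis using Cons[of "snd pq"]
      by (cases pq; cases "fst pq"; cases "snd pq"; cases s) (auto simp: brandt_act_append brandt_act_0)
  qed
qed simp

lemma brandt_state_eq_iff: "brandt_state a = brandt_state b \<longleftrightarrow> a = b"
  by (cases a rule: brandt_state.cases; cases b rule: brandt_state.cases; simp)

lemma eval_brandt: "eval_word brandt_monoid (\<lambda>x. brandt_class (f x)) w = brandt_class (concat (map f w))"
proof (induction w)
  case Nil
  show ?case by (simp add: brandt_monoid_def)
qed (simp add: brandt_class_mult)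

text \<open>Choosing \<open>\<psi>\<close> amounts to choosing an assignment into the Brandt monoid,
  whose elements other than 0 and 1 each move exactly one of the two points.\<close>

lemma brandt_satisfies_run:
  assumes "satisfies brandt_monoid (u, v)"
  shows "run \<psi> u s = run \<psi> v s"
proof -
  let ?f = "\<lambda>x. brandt_class ((brandt_word \<circ> \<psi>) x)"
  have "?f \<in> UNIV \<rightarrow> carrier brandt_monoid" by (auto simp: brandt_monoid_def)
  with assms have "eval_word brandt_monoid ?f u = eval_word brandt_monoid ?f v"
    unfolding satisfies_def by (metis fst_conv snd_conv)
  then have "brandt_cong (concat (map (brandt_word \<circ> \<psi>) u)) (concat (map (brandt_word \<circ> \<psi>) v))"
    by (simp only: eval_brandt brandt_class_eq_iff)
  then have "brandt_state (run \<psi> u s) = brandt_state (run \<psi> v s)"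
    unfolding brandt_act_run[symmetric] by (rule brandt_cong_act)
  then show ?thesis by (simp add: brandt_state_eq_iff)
qed

lemma brandt_square_eq_cube: "satisfies brandt_monoid ([0, 0], [0, 0, 0])"
proof -
  have "brandt_cong (w @ w) (w @ w @ w)" for w
  proof -
    obtain v where v: "v \<in> {[], [GenA], [GenB], [GenA, GenB], [GenB, GenA], [Gen0]}"
      and wv: "brandt_cong w v" using brandt_normal_form by blast
    have r: "brandt_cong (p @ x @ q) (p @ y @ q)" if "brandt_rel x y" for p q x y
      using that by (rule brandt_cong.rel)
    note r3 = r[OF brandt_rel.intros(3)] and r4 = r[OF brandt_rel.intros(4)]
      and r1 = r[OF brandt_rel.intros(1)] and r2 = r[OF brandt_rel.intros(2)]
    have r5: "brandt_cong (p @ [Gen0, g] @ q) (p @ [Gen0] @ q)" for p g q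
      by (rule r[OF brandt_rel.intros(5)])
    have "brandt_cong (v @ v) (v @ v @ v)"
      using v
      apply (elim insertE emptyE; simp)
      subgoal by (rule brandt_cong.refl)
      subgoal using r3[of "[]" "[]"] r3[of "[]" "[GenA]"] r5[where p = "[]" and q = "[]" and g = GenA]
        by simp (meson brandt_cong.sym brandt_cong.trans)
      subgoal using r4[of "[]" "[]"] r4[of "[]" "[GenB]"] r5[where p = "[]" and q = "[]" and g = GenB]
        by simp (meson brandt_cong.sym brandt_cong.trans)
      subgoal using r1[of "[]" "[GenB, GenA, GenB]"] by simp (rule brandt_cong.sym)
      subgoal using r2[of "[]" "[GenA, GenB, GenA]"] by simp (rule brandt_cong.sym)
      subgoal using r5[where p = "[]" and q = "[Gen0]" and g = Gen0] by simp (rule brandt_cong.sym)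
      done
    moreover have "brandt_cong (w @ w) (v @ v)" "brandt_cong (w @ w @ w) (v @ v @ v)"
      using wv by (auto intro: brandt_cong_append)
    ultimately show ?thesis using brandt_cong.trans brandt_cong.sym by blast
  qed
  then have c: "brandt_class w \<otimes>\<^bsub>brandt_monoid\<^esub> brandt_class w =
      brandt_class w \<otimes>\<^bsub>brandt_monoid\<^esub> (brandt_class w \<otimes>\<^bsub>brandt_monoid\<^esub> brandt_class w)" for w
    by (simp add: brandt_class_mult brandt_class_eq_iff)
  interpret monoid brandt_monoid by (rule monoid_brandt)
  show ?thesis
    unfolding satisfies_def
  proof
    fix \<phi> :: "nat \<Rightarrow> _" assume "\<phi> \<in> UNIV \<rightarrow> carrier brandt_monoid"
    then have m: "\<phi> 0 \<in> carrier brandt_monoid" by auto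
    then obtain w where w: "\<phi> 0 = brandt_class w" by (auto simp: brandt_monoid_def)
    show "eval_word brandt_monoid \<phi> (fst ([0, 0], [0, 0, 0])) = eval_word brandt_monoid \<phi> (snd ([0, 0], [0, 0, 0]))"
      using c[of w, folded w] m by simp
  qed
qed

text \<open>
  Once the other letters are fixed, a letter \<open>x\<close> acting as \<open>False \<mapsto> True\<close> can be inserted in only
  one way: the two neighbouring letters tell whether a step from \<open>False\<close> to \<open>True\<close> is missing.
\<close>

lemma run_insertion_unique:
  assumes "\<psi> x = Some (False, True)" "run \<psi> u s = Some r" "run \<psi> v s = Some r"
    and "filter (\<lambda>z. \<psi> z \<noteq> None \<and> z \<noteq> x) u = filter (\<lambda>z. \<psi> z \<noteq> None \<and> z \<noteq> x) v"
  shows "filter (\<lambda>z. \<psi> z \<noteq> None) u = filter (\<lambda>z. \<psi> z \<noteq> None) v"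
proof -
  have *: "u = v" if "run \<psi> u s = Some r" "run \<psi> v s = Some r" "\<forall>z \<in> set u \<union> set v. \<psi> z \<noteq> None"
    "filter (\<lambda>z. z \<noteq> x) u = filter (\<lambda>z. z \<noteq> x) v" for u v s
    using that
  proof (induction u v arbitrary: s rule: list_induct2')
    case (2 a u)
    then show ?case using assms(1) by (cases u) (auto split: if_splits)
  next
    case (3 b v)
    then show ?case using assms(1) by (cases v) (auto split: if_splits)
  next
    case (4 a u b v)
    consider "a = b" | "a = x" "b \<noteq> x" | "b = x" "a \<noteq> x" | "a \<noteq> x" "b \<noteq> x" "a \<noteq> b" by blast
    then show ?case
    proof cases
      case 1
      then obtain p q where "\<psi> a = Some (p, q)" using 4 by auto
      then show ?thesis using 1 4(1)[of q] 4(2-) by (auto split: if_splits)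
    next
      \<comment> \<open>After \<open>x\<close> the state is \<open>True\<close>, so the next letter
        of the first word is not \<open>x\<close> and has to be \<open>b\<close>. The first word
        then reads \<open>b\<close> in state \<open>True\<close> and the second one reads it in
        state \<open>False\<close>, but only one of these is possible.\<close>
      case 2
      then obtain c u' where u: "u = c # u'" using 4 by (cases u) auto
      with 2 have "c \<noteq> x" using 4 assms(1) by (auto split: if_splits)
      then have "c = b" using 4 2 u by auto
      then show ?thesis using 4 2 u assms(1) by (auto split: if_splits option.splits)
    next
      case 3
      then obtain c v' where v: "v = c # v'" using 4 by (cases v) auto
      with 3 have "c \<noteq> x" using 4 assms(1) by (auto split: if_splits)
      then have "c = a" using 4 3 v by auto
      then show ?thesis using 4 3 v assms(1) by (auto split: if_splits option.splits)
    qed (use 4 in auto)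
  qed simp
  have run_filter: "run \<psi> (filter (\<lambda>z. \<psi> z \<noteq> None) w) s = run \<psi> w s" for w s
    by (induction w arbitrary: s) (auto split: option.splits)
  show ?thesis
    by (rule * [where s = s]) (use assms in \<open>auto simp add: run_filter conj_commute simp del: not_None_eq\<close>)
qed

text \<open>The engine of the isoterm proofs: a letter is added to a projection already known to
  agree, and all that has to be found is a \<open>\<psi>\<close> under which \<open>u\<close> runs
  to the end.\<close>

lemma brandt_insertion:
  assumes "satisfies brandt_monoid (u, v)" "\<psi> x = Some (False, True)" "run \<psi> u s \<noteq> None"
    and "filter (\<lambda>z. \<psi> z \<noteq> None \<and> z \<noteq> x) u = filter (\<lambda>z. \<psi> z \<noteq> None \<and> z \<noteq> x) v"
  shows "filter (\<lambda>z. \<psi> z \<noteq> None) u = filter (\<lambda>z. \<psi> z \<noteq> None) v"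
  using run_insertion_unique[of \<psi> x u s _ v] assms brandt_satisfies_run[OF assms(1), of \<psi> s] by auto

text \<open>Let a letter missing from \<open>u\<close> lead from \<open>False\<close> to
  \<open>True\<close> and erase all others: \<open>u\<close> stays in \<open>False\<close>, while
  \<open>v\<close> leaves it and cannot return.\<close>

lemma brandt_content:
  assumes "satisfies brandt_monoid (u, v)"
  shows "set v \<subseteq> set u"
proof
  fix x assume "x \<in> set v"
  show "x \<in> set u"
  proof (rule ccontr)
    assume x: "x \<notin> set u"
    define \<psi> where "\<psi> = (\<lambda>z. if z = x then Some (False, True) else None)"
    have "run \<psi> u s = Some s" for s
      using x by (induction u arbitrary: s) (auto simp: \<psi>_def)
    then have "run \<psi> v False = Some False" using brandt_satisfies_run[OF assms] by metis
    moreover have "run \<psi> w True \<noteq> Some False" for w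
      by (induction w) (auto simp: \<psi>_def)
    then have "run \<psi> w False \<noteq> Some False" if "x \<in> set w" for w
      using that by (induction w) (auto simp: \<psi>_def)
    ultimately show False using \<open>x \<in> set v\<close> by blast
  qed
qed

definition interleave :: "'x \<Rightarrow> 'x list \<Rightarrow> 'x list" where
  "interleave a c = a # concat (map (\<lambda>x. [x, a]) c)"

lemma interleave_simps [simp]:
  "interleave a [] = [a]"
  "interleave a (x # c) = a # x # interleave a c"
  by (simp_all add: interleave_def)

lemma interleave_append: "interleave a (c @ x # d) = interleave a c @ x # interleave a d"
  by (induction c) simp_all

lemma filter_concat_subst: "filter P u = concat (map (\<lambda>x. if P x then [x] else []) u)"
  by (induction u) auto

text \<open>Erasing letters is a substitution, because words may be empty.\<close>

lemma satisfies_filter: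
  assumes "monoid M" "satisfies M (u, v)"
  shows "satisfies M (filter P u, filter P v)"
  unfolding filter_concat_subst by (rule monoid.satisfies_subst[OF assms])

text \<open>With \<open>a\<close> leading from \<open>False\<close> to \<open>True\<close> and every
  other letter leading back, the alternating word runs to the end. Deleting \<open>a\<close> leaves
  the isoterm \<open>c\<close>, so only the places of \<open>a\<close> are in question.\<close>

lemma isoterm_interleave:
  assumes "isoterm brandt_monoid c" "a \<notin> set c"
  shows "isoterm brandt_monoid (interleave a c)"
  unfolding isoterm_def
proof (intro allI impI)
  fix v assume s: "satisfies brandt_monoid (interleave a c, v)"
  have f: "filter (\<lambda>z. z \<noteq> a) (interleave a c) = c"
    using assms(2) by (induction c) auto
  then have fv: "filter (\<lambda>z. z \<noteq> a) v = c"
    using satisfies_filter[OF monoid_brandt s, of "\<lambda>z. z \<noteq> a"] assms(1) by (simp add: isoterm_def)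
  define \<psi> where "\<psi> = (\<lambda>z. if z = a then Some (False, True) else Some (True, False))"
  have "run \<psi> (interleave a c) False = Some True"
    using assms(2) by (induction c) (auto simp: \<psi>_def)
  moreover have "\<psi> a = Some (False, True)" "\<And>z. (\<psi> z \<noteq> None) = True" by (simp_all add: \<psi>_def del: not_None_eq)
  ultimately show "v = interleave a c"
    using brandt_insertion[OF s, of \<psi> a False] f fv by (simp del: not_None_eq)
qed

lemma isoterm_map_Suc:
  assumes "isoterm brandt_monoid c"
  shows "isoterm brandt_monoid (map Suc c)"
  unfolding isoterm_def
proof (intro allI impI)
  fix v assume s: "satisfies brandt_monoid (map Suc c, v)"
  have "satisfies brandt_monoid (concat (map (\<lambda>x. [x - 1]) (map Suc c)), concat (map (\<lambda>x. [x - 1]) v))"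
    by (rule monoid.satisfies_subst[OF monoid_brandt s])
  then have "satisfies brandt_monoid (c, map (\<lambda>x. x - 1) v)" by (simp add: comp_def)
  then have "map (\<lambda>x. x - 1) v = c" using assms by (simp add: isoterm_def)
  \<comment> \<open>Truncated subtraction merges the letters 0 and 1; the content of
    \<open>v\<close> excludes 0.\<close>
  moreover have "Suc (x - 1) = x" if "x \<in> set v" for x
    using brandt_content[OF s] that by auto
  ultimately show "v = map Suc c" by (auto simp: map_idI)
qed

lemma isoterm_Nil: "isoterm brandt_monoid []"
  unfolding isoterm_def using brandt_content by fastforce

text \<open>The recursion turned inside out: the smallest letter is inserted everywhere instead of a
  new largest one in the middle. The isoterm property and the 2-adic formula for the letters both
  rest on this form.\<close>

lemma zimin_Suc_interleave: "zimin (Suc n) = interleave 0 (map Suc (zimin n))"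
proof (induction n)
  case (Suc n)
  have "zimin (Suc (Suc n)) = zimin (Suc n) @ Suc (Suc n) # zimin (Suc n)" by simp
  also have "\<dots> = interleave 0 (map Suc (zimin n) @ Suc (Suc n) # map Suc (zimin n))"
    by (simp only: Suc interleave_append)
  finally show ?case by simp
qed simp

lemma isoterm_zimin: "isoterm brandt_monoid (zimin n)"
proof (induction n)
  case 0
  show ?case using isoterm_interleave[OF isoterm_Nil, of 0] by simp
next
  case (Suc n)
  then show ?case unfolding zimin_Suc_interleave
    by (intro isoterm_interleave isoterm_map_Suc) auto
qed

definition zimin_factors :: "word set" where
  "zimin_factors = {w. factor_of_inf w zimin_inf}"

lemma zimin_eq_map: "zimin n = map zimin_inf [0..<length (zimin n)]"
  by (rule nth_equalityI) (auto simp: zimin_inf_nth)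

lemma sublist_map_upt:
  assumes "a \<le> i" "i \<le> j" "j \<le> m"
  shows "sublist (map f [i..<j]) (map f [a..<m])"
proof -
  have "[a..<m] = [a..<i] @ [i..<j] @ [j..<m]"
    using assms upt_add_eq_append[of a i "m - i"] upt_add_eq_append[of i j "m - j"] by simp
  then show ?thesis by (auto simp: sublist_def)
qed

lemma zimin_factors_iff: "w \<in> zimin_factors \<longleftrightarrow> (\<exists>n. sublist w (zimin n))"
proof
  assume "w \<in> zimin_factors"
  then obtain k where k: "w = map zimin_inf [k..<k + length w]"
    by (auto simp: zimin_factors_def factor_of_inf_def)
  let ?n = "k + length w"
  have "sublist (map zimin_inf [k..<?n]) (map zimin_inf [0..<length (zimin ?n)])"
    using length_zimin_gt[of ?n] by (intro sublist_map_upt) auto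
  then show "\<exists>n. sublist w (zimin n)" using k zimin_eq_map by metis
next
  assume "\<exists>n. sublist w (zimin n)"
  then obtain n p q where "zimin n = p @ w @ q" by (auto simp: sublist_def)
  moreover have "factor_of_inf (zimin n) zimin_inf"
    unfolding factor_of_inf_def using zimin_eq_map by (metis add_0)
  ultimately show "w \<in> zimin_factors"
    unfolding zimin_factors_def using factor_of_inf_infix by simp
qed

lemma isoterm_zimin_factors: "w \<in> zimin_factors \<Longrightarrow> isoterm brandt_monoid w"
  unfolding zimin_factors_iff using isoterm_sublist monoid_brandt isoterm_zimin by blast

lemma square_free_of_isoterms:
  "isoterm brandt_monoid w \<Longrightarrow> sublist (u @ u) w \<Longrightarrow> u = []"
  by (rule isoterm_square_free[OF monoid_brandt brandt_square_eq_cube])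

lemma factorial_language_isoterms:
  assumes "L \<subseteq> Collect (isoterm brandt_monoid)" "[] \<in> L"
    "\<And>u w. w \<in> L \<Longrightarrow> sublist u w \<Longrightarrow> u \<in> L"
  shows "factorial_language L"
proof
  have "\<not> isoterm brandt_monoid [0, 0]"
    using square_free_of_isoterms[of "[0, 0]" "[0]"] by auto
  then show "L \<noteq> UNIV" using assms(1) by blast
qed (use assms in auto)

lemma factorial_zimin_factors: "factorial_language zimin_factors"
proof (rule factorial_language_isoterms)
  show "[] \<in> zimin_factors" by (simp add: zimin_factors_iff)
  show "u \<in> zimin_factors" if "w \<in> zimin_factors" "sublist u w" for u w
    using that unfolding zimin_factors_iff using sublist_order.order_trans by blast
qed (use isoterm_zimin_factors in blast)

lemma M_zimin_eq: "M_zimin = word_monoid zimin_factors"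
proof -
  have "factor_mult zimin_inf x y = word_mult zimin_factors x y" for x y
    by (cases x; cases y) (auto simp: zimin_factors_def)
  then have "factor_mult zimin_inf = word_mult zimin_factors" by (intro ext)
  moreover have "factor_carrier zimin_inf = insert Zero (Factor ` {w \<in> zimin_factors. w \<noteq> []})"
    by (auto simp: factor_carrier_def zimin_factors_def)
  ultimately show ?thesis by (simp add: M_zimin_def word_monoid_def)
qed

lemma square_not_mem:
  assumes "L \<subseteq> Collect (isoterm brandt_monoid)" "p @ u @ u @ q \<in> L"
  shows "u = []"
proof (rule square_free_of_isoterms)
  show "isoterm brandt_monoid (p @ u @ u @ q)" using assms by blast
  show "sublist (u @ u) (p @ u @ u @ q)"
    unfolding sublist_def by (metis append.assoc)
qed

text \<open>A nonempty image of the squared letter puts a square into both sides, which makes them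
  zero; an empty image makes them equal.\<close>

lemma (in factorial_language) satisfies_square_central:
  assumes "L \<subseteq> Collect (isoterm brandt_monoid)"
  shows "satisfies (word_monoid L) ([0, 0, 1], [1, 0, 0])"
proof -
  have "g 0 @ g 0 @ g 1 = g 1 @ g 0 @ g 0" if "g 0 @ g 0 @ g 1 \<in> L \<or> g 1 @ g 0 @ g 0 \<in> L" for g :: "nat \<Rightarrow> word"
    using that square_not_mem[OF assms, of "[]" "g 0" "g 1"] square_not_mem[OF assms, of "g 1" "g 0" "[]"]
    by auto
  then show ?thesis by (auto simp: satisfies_word_monoid)
qed


section \<open>Cycle words and their identities\<close>

text \<open>
  The letter \<open>a\<close> is \<open>0\<close>, \<open>vtx i\<close> is \<open>b\<^sub>i\<close>, and \<open>sep k\<close> is the linear letter closing the \<open>k\<close>-th arc. Arcs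
  \<open>2 * i\<close> and \<open>2 * i + 1\<close> are the two orientations of the edge from \<open>i\<close> to \<open>i + 1\<close> modulo \<open>n\<close>.
\<close>

definition vtx :: "nat \<Rightarrow> nat" where "vtx i = 2 * i + 1"
definition sep :: "nat \<Rightarrow> nat" where "sep k = 2 * k + 2"

lemma letter_simps [simp]:
  "vtx i = vtx j \<longleftrightarrow> i = j" "sep i = sep j \<longleftrightarrow> i = j" "vtx i \<noteq> sep k" "sep k \<noteq> vtx i"
  "vtx i \<noteq> 0" "sep k \<noteq> 0" "0 \<noteq> vtx i" "0 \<noteq> sep k"
  unfolding vtx_def sep_def by presburger+

definition src :: "nat \<Rightarrow> nat \<Rightarrow> nat" where
  "src n k = (if even k then k div 2 else Suc (k div 2) mod n)"
definition tgt :: "nat \<Rightarrow> nat \<Rightarrow> nat" where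
  "tgt n k = (if even k then Suc (k div 2) mod n else k div 2)"

definition cycle_word :: "nat \<Rightarrow> word" where
  "cycle_word n = concat (map (\<lambda>k. [vtx (src n k), vtx (tgt n k), sep k]) [0..<2 * n])"

lemma Suc_mod_neq: "2 \<le> n \<Longrightarrow> i < n \<Longrightarrow> Suc i mod n \<noteq> i"
  by (cases "Suc i = n") auto

lemma src_neq_tgt: "2 \<le> n \<Longrightarrow> k < 2 * n \<Longrightarrow> src n k \<noteq> tgt n k"
  using Suc_mod_neq[of n "k div 2"] by (auto simp: src_def tgt_def)

lemma src_tgt_less: "k < 2 * n \<Longrightarrow> src n k < n" "k < 2 * n \<Longrightarrow> tgt n k < n"
  by (auto simp: src_def tgt_def intro: mod_less_divisor)

lemma length_cycle_word: "length (cycle_word n) = 6 * n"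
  by (simp add: cycle_word_def length_concat comp_def sum_list_triv)

lemma set_cycle_word: "set (cycle_word n) \<subseteq> vtx ` {..<n} \<union> sep ` {..<2 * n}"
  using src_tgt_less by (auto simp: cycle_word_def)

lemma run_concat:
  assumes "\<And>k. k < K \<Longrightarrow> run \<psi> (f k) (p k) = Some (p (Suc k))"
  shows "run \<psi> (concat (map f [0..<K])) (p 0) = Some (p K)"
  using assms by (induction K) (auto simp: run_append)

lemma filter_subset_cong:
  assumes "filter P u = filter P v" "\<And>x. Q x \<Longrightarrow> P x"
  shows "filter Q u = filter Q v"
proof -
  have "filter Q w = filter Q (filter P w)" for w
    using assms(2) by (auto intro: filter_cong)
  then show ?thesis using assms(1) by metis
qed

definition is_sep :: "nat \<Rightarrow> bool" where "is_sep z \<longleftrightarrow> (\<exists>k. z = sep k)"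
definition sep_index :: "nat \<Rightarrow> nat" where "sep_index z = (z - 2) div 2"

lemma sep_index_sep [simp]: "sep_index (sep k) = k"
  by (simp add: sep_index_def sep_def)

lemma is_sep_simps [simp]: "is_sep (sep k)" "\<not> is_sep (vtx i)"
  by (auto simp: is_sep_def)

text \<open>Three rounds of \<open>brandt_insertion\<close> recover the projections to the
  separators, to the separators with one vertex letter, and to the separators with two vertex
  letters. Every pair of letters is covered by one of these, so \<open>filter_pairs_eqI\<close>
  finishes.\<close>

lemma isoterm_cycle_word:
  assumes n: "2 \<le> n"
  shows "isoterm brandt_monoid (cycle_word n)"
  unfolding isoterm_def
proof (intro allI impI)
  let ?c = "cycle_word n"
  fix v assume s: "satisfies brandt_monoid (?c, v)"
  have run_c: "run \<psi> ?c (p 0) \<noteq> None"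
    if "\<And>k. k < 2 * n \<Longrightarrow> run \<psi> [vtx (src n k), vtx (tgt n k), sep k] (p k) = Some (p (Suc k))" for \<psi> p
    unfolding cycle_word_def using run_concat[of "2 * n" \<psi> _ p, OF that] by (simp del: run.simps)
  have seps: "filter (\<lambda>z. \<exists>j<k. z = sep j) ?c = filter (\<lambda>z. \<exists>j<k. z = sep j) v" for k
  proof (induction k)
    case (Suc k)
    \<comment> \<open>The earlier separators loop at \<open>False\<close> and \<open>sep k\<close>
      leaves that state; in \<open>cycle_word n\<close> it comes after all of them.\<close>
    define \<psi> where "\<psi> = (\<lambda>z. if z = sep k then Some (False, True)
      else if \<exists>j<k. z = sep j then Some (False, False) else None)"
    have dom: "\<psi> z \<noteq> None \<longleftrightarrow> (\<exists>j<Suc k. z = sep j)" for z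
      by (auto simp: \<psi>_def less_Suc_eq)
    have rest: "\<psi> z \<noteq> None \<and> z \<noteq> sep k \<longleftrightarrow> (\<exists>j<k. z = sep j)" for z
      by (auto simp: \<psi>_def)
    have "run \<psi> ?c (k < 0) \<noteq> None"
      by (rule run_c) (auto simp: \<psi>_def)
    from brandt_insertion[OF s _ this, of "sep k"] show ?case
      unfolding rest unfolding dom using Suc by (simp add: \<psi>_def)
  qed simp
  have seps: "filter is_sep ?c = filter is_sep v"
  proof -
    have "filter is_sep w = filter (\<lambda>z. \<exists>j<2 * n. z = sep j) w" if "set w \<subseteq> set ?c" for w
      using that set_cycle_word[of n] by (intro filter_cong) (auto simp: is_sep_def)
    then show ?thesis using seps[of "2 * n"] brandt_content[OF s] by simp
  qed
  have one: "filter (\<lambda>z. is_sep z \<or> z = vtx i) ?c = filter (\<lambda>z. is_sep z \<or> z = vtx i) v" for i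
  proof -
    \<comment> \<open>Each separator resets the state to \<open>False\<close>. Its required state
      records whether \<open>vtx i\<close> occurs in its block, where it occurs at most once because
      the ends of an arc differ.\<close>
    define \<psi> where "\<psi> = (\<lambda>z. if z = vtx i then Some (False, True) else if is_sep z
      then Some (src n (sep_index z) = i \<or> tgt n (sep_index z) = i, False) else None)"
    have dom: "\<psi> z \<noteq> None \<longleftrightarrow> is_sep z \<or> z = vtx i" for z
      by (auto simp: \<psi>_def)
    have rest: "\<psi> z \<noteq> None \<and> z \<noteq> vtx i \<longleftrightarrow> is_sep z" for z
      by (auto simp: \<psi>_def)
    have "run \<psi> ?c ((\<lambda>_. False) 0) \<noteq> None"
      by (rule run_c) (use src_neq_tgt[OF n] in \<open>auto simp: \<psi>_def\<close>)
    from brandt_insertion[OF s _ this, of "vtx i"] show ?thesis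
      unfolding rest unfolding dom using seps by (simp add: \<psi>_def)
  qed
  have two: "filter (\<lambda>z. is_sep z \<or> z = vtx i \<or> z = vtx j) ?c =
      filter (\<lambda>z. is_sep z \<or> z = vtx i \<or> z = vtx j) v" if "i \<noteq> j" for i j
  proof -
    \<comment> \<open>\<open>vtx j\<close> and \<open>vtx i\<close> move in opposite directions.
      \<open>p k\<close> is the state in which block \<open>k\<close> must start
      (\<open>True\<close> if \<open>vtx i\<close> comes first) and \<open>q k\<close> the state
      after its vertex letters (\<open>True\<close> if \<open>vtx j\<close> comes last). The
      separator leads from \<open>q k\<close> to the start of the next block, whence the
      \<open>Suc\<close>.\<close>
    define p where "p = (\<lambda>k. src n k = i \<or> src n k \<noteq> j \<and> tgt n k = i)"
    define q where "q = (\<lambda>k. tgt n k = j \<or> tgt n k \<noteq> i \<and> src n k = j)"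
    define \<psi> where "\<psi> = (\<lambda>z. if z = vtx j then Some (False, True) else if z = vtx i then Some (True, False)
      else if is_sep z then Some (q (sep_index z), p (Suc (sep_index z))) else None)"
    have dom: "\<psi> z \<noteq> None \<longleftrightarrow> is_sep z \<or> z = vtx i \<or> z = vtx j" for z
      by (auto simp: \<psi>_def)
    have rest: "\<psi> z \<noteq> None \<and> z \<noteq> vtx j \<longleftrightarrow> is_sep z \<or> z = vtx i" for z
      using that by (auto simp: \<psi>_def)
    have "run \<psi> ?c (p 0) \<noteq> None"
    proof (rule run_c)
      fix k assume "k < 2 * n"
      then have "src n k \<noteq> tgt n k" by (rule src_neq_tgt[OF n])
      then show "run \<psi> [vtx (src n k), vtx (tgt n k), sep k] (p k) = Some (p (Suc k))"
        using that by (auto simp: \<psi>_def p_def q_def)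
    qed
    from brandt_insertion[OF s _ this, of "vtx j"] show ?thesis
      unfolding rest unfolding dom using one[of i] by (simp add: \<psi>_def)
  qed
  have "?c = v"
  proof (rule filter_pairs_eqI)
    fix x y assume "x \<in> set ?c \<union> set v" "y \<in> set ?c \<union> set v"
    then have "x \<in> set ?c" "y \<in> set ?c" using brandt_content[OF s] by auto
    then have "is_sep x \<or> (\<exists>i. x = vtx i)" "is_sep y \<or> (\<exists>j. y = vtx j)"
      using set_cycle_word[of n] by auto
    then obtain i j where ij: "is_sep x \<or> x = vtx i" "is_sep y \<or> y = vtx j" "i \<noteq> j \<or> x = y \<or> is_sep x \<or> is_sep y"
      by metis
    consider "is_sep x" "is_sep y" | "is_sep x" "y = vtx j" | "is_sep y" "x = vtx i" | "x = y" "y = vtx j"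
      | "x = vtx i" "y = vtx j" "i \<noteq> j"
      using ij by blast
    then show "filter (\<lambda>z. z = x \<or> z = y) ?c = filter (\<lambda>z. z = x \<or> z = y) v"
    proof cases
      case 1
      then show ?thesis by (intro filter_subset_cong[OF seps]) auto
    next
      case 2
      then show ?thesis by (intro filter_subset_cong[OF one[of j]]) auto
    next
      case 3
      then show ?thesis by (intro filter_subset_cong[OF one[of i]]) auto
    next
      case 4
      then show ?thesis by (intro filter_subset_cong[OF one[of j]]) auto
    next
      case 5
      then show ?thesis by (intro filter_subset_cong[OF two[of i j]]) auto
    qed
  qed
  then show "v = ?c" by simp
qed

section \<open>The 2-adic structure of the limit word\<close>

lemma length_interleave: "length (interleave a c) = 2 * length c + 1"
  by (induction c) auto

lemma interleave_nth:
  "i \<le> length c \<Longrightarrow> interleave a c ! (2 * i) = a"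
  "i < length c \<Longrightarrow> interleave a c ! (2 * i + 1) = c ! i"
proof (induction c arbitrary: i)
  case (Cons x c)
  {
    case 1
    then show ?case using Cons by (cases i) auto
  next
    case 2
    then show ?case using Cons by (cases i) auto
  }
qed simp_all

lemma zimin_inf_double: "zimin_inf (2 * i) = 0" "zimin_inf (2 * i + 1) = Suc (zimin_inf i)"
proof -
  have i: "i < length (zimin i)" by (rule length_zimin_gt)
  have l: "length (zimin (Suc i)) = 2 * length (zimin i) + 1" by simp
  have "zimin_inf (2 * i) = zimin (Suc i) ! (2 * i)"
    by (rule zimin_inf_nth) (use i l in linarith)
  then show "zimin_inf (2 * i) = 0"
    unfolding zimin_Suc_interleave using i by (simp add: interleave_nth)
  have "zimin_inf (2 * i + 1) = zimin (Suc i) ! (2 * i + 1)"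
    by (rule zimin_inf_nth) (use i l in linarith)
  then show "zimin_inf (2 * i + 1) = Suc (zimin_inf i)"
    unfolding zimin_Suc_interleave zimin_inf_def[of i] using i by (simp only: interleave_nth length_map nth_map)
qed

text \<open>The limit word is the ruler sequence: with positions counted from 1, each letter is the
  exponent of 2 in its position.\<close>

lemma le_zimin_inf_iff: "k \<le> zimin_inf i \<longleftrightarrow> 2 ^ k dvd Suc i"
proof (induction k arbitrary: i)
  case (Suc k)
  show ?case
  proof (cases "even i")
    case True
    then obtain m where m: "i = 2 * m" by blast
    have "\<not> 2 ^ Suc k dvd Suc (2 * m)" by (metis dvd_mult_left even_Suc even_mult_iff even_numeral power_Suc)
    then show ?thesis using zimin_inf_double(1)[of m] m by simp
  next
    case False
    then obtain m where m: "i = 2 * m + 1" by (elim oddE)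
    have "2 ^ Suc k dvd Suc (2 * m + 1) \<longleftrightarrow> 2 * 2 ^ k dvd 2 * Suc m" by simp
    also have "\<dots> \<longleftrightarrow> 2 ^ k dvd Suc m" by (subst dvd_times_left_cancel_iff) auto
    finally show ?thesis using zimin_inf_double(2)[of m] m Suc by simp
  qed
qed simp

definition occurs_at :: "word \<Rightarrow> nat \<Rightarrow> bool" where
  "occurs_at w p \<longleftrightarrow> w = map zimin_inf [p..<p + length w]"

lemma zimin_factors_occurs: "w \<in> zimin_factors \<longleftrightarrow> (\<exists>p. occurs_at w p)"
  by (simp add: zimin_factors_def factor_of_inf_def occurs_at_def)

lemma occurs_at_append:
  assumes "occurs_at (u @ v) p"
  shows "occurs_at u p \<and> occurs_at v (p + length u)"
proof -
  let ?w = "map zimin_inf [p..<p + length (u @ v)]"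
  have w: "u @ v = ?w" using assms by (simp only: occurs_at_def)
  have "u = take (length u) ?w" "v = drop (length u) ?w" unfolding w[symmetric] by simp_all
  then show ?thesis unfolding occurs_at_def by (simp add: take_map drop_map take_upt drop_upt add.assoc)
qed

text \<open>A nonempty word whose length is a multiple of \<open>2 ^ k\<close> covers a position
  divisible by \<open>2 ^ k\<close> (counted from 1). The letter found there tells whether the
  position is divisible by \<open>2 ^ Suc k\<close>, and it is the same letter in both
  occurrences.\<close>

lemma occurs_at_cong_step:
  assumes w: "occurs_at w p" "occurs_at w p'" "w \<noteq> []"
    and len: "2 ^ k dvd length w" and pp: "(2 :: int) ^ k dvd int p - int p'"
  shows "(2 :: int) ^ Suc k dvd int p - int p'"
proof -
  \<comment> \<open>The offset that raises \<open>Suc (p + j)\<close> to the next multiple of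
    \<open>2 ^ k\<close>.\<close>
  define j where "j = 2 ^ k - 1 - p mod 2 ^ k"
  have plt: "p mod 2 ^ k < 2 ^ k" by simp
  then have "Suc (p + j) = 2 ^ k * (p div 2 ^ k) + 2 ^ k"
    using mult_div_mod_eq[of "2 ^ k" p] unfolding j_def by linarith
  then have P: "2 ^ k dvd Suc (p + j)" by simp
  have "2 ^ k \<le> length w" using len w(3) by (auto intro: dvd_imp_le)
  then have j: "j < length w" using plt unfolding j_def by linarith
  have eq: "zimin_inf (p + j) = zimin_inf (p' + j)"
  proof -
    have "w ! j = zimin_inf (p + j)" using w(1) j unfolding occurs_at_def
      by (metis add_diff_cancel_left' length_upt nth_map nth_upt add_less_cancel_left)
    moreover have "w ! j = zimin_inf (p' + j)" using w(2) j unfolding occurs_at_def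
      by (metis add_diff_cancel_left' length_upt nth_map nth_upt add_less_cancel_left)
    ultimately show ?thesis by simp
  qed
  then have iff: "2 ^ Suc k dvd Suc (p + j) \<longleftrightarrow> 2 ^ Suc k dvd Suc (p' + j)"
    by (simp only: le_zimin_inf_iff[symmetric])
  have P': "2 ^ k dvd Suc (p' + j)" using P eq by (simp only: le_zimin_inf_iff[symmetric])
  obtain a where a: "Suc (p + j) = 2 ^ k * a" using P by blast
  obtain b where b: "Suc (p' + j) = 2 ^ k * b" using P' by blast
  have "even a \<longleftrightarrow> even b"
    using iff unfolding a b by (simp add: mult.commute[of 2])
  then have ev: "even (int a - int b)" by simp
  have "int p - int p' = int (Suc (p + j)) - int (Suc (p' + j))" by simp
  also have "\<dots> = 2 ^ k * (int a - int b)" unfolding a b by (simp add: algebra_simps)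
  finally show ?thesis using ev by (simp add: mult.commute[of 2])
qed

text \<open>
  Start positions and lengths agree modulo every power of two, by induction on the exponent: modulo
  \<open>2\<^sup>k\<^sup>+\<^sup>1\<close> all \<open>D i\<close> have the same length \<open>\<lambda>\<close>, and going once around the cycle shifts the
  start by \<open>n * \<lambda>\<close>.
\<close>

lemma cycle_avoided_by_zimin:
  assumes n: "odd n" and D: "\<And>k. k < 2 * n \<Longrightarrow> D (src n k) @ D (tgt n k) \<in> zimin_factors"
    and ne: "\<And>i. i < n \<Longrightarrow> D i \<noteq> []"
  shows False
proof -
  have n0: "0 < n" using n by (cases n) auto
  have inv: "(\<forall>i<n. (2 :: int) ^ k dvd int (length (D i))) \<and>
    (\<forall>i<n. \<forall>j<n. \<forall>p q. occurs_at (D i) p \<longrightarrow> occurs_at (D j) q \<longrightarrow> (2 :: int) ^ k dvd int p - int q)" for k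
  proof (induction k)
    case (Suc k)
    let ?M = "(2 :: int) ^ Suc k"
    define len where "len = (\<lambda>i. int (length (D i)))"
    have same: "?M dvd int p - int q" if "i < n" "occurs_at (D i) p" "occurs_at (D i) q" for i p q
    proof (rule occurs_at_cong_step)
      show "2 ^ k dvd length (D i)"
        using Suc that(1) by (metis int_dvd_int_iff of_nat_numeral of_nat_power)
    qed (use Suc that ne in auto)
    have arc: "\<exists>q. occurs_at (D (src n k)) q \<and> occurs_at (D (tgt n k)) (q + length (D (src n k)))"
      if "k < 2 * n" for k
      using D[OF that] occurs_at_append by (auto simp: zimin_factors_occurs)
    have "\<exists>p. occurs_at (D i) p" if "i < n" for i
      using arc[of "2 * i"] that by (auto simp: src_def)
    then obtain p where p: "\<And>i. i < n \<Longrightarrow> occurs_at (D i) (p i)" by metis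
    have step: "?M dvd int (p (tgt n k)) - int (p (src n k)) - len (src n k)" if k: "k < 2 * n" for k
    proof -
      obtain q where q: "occurs_at (D (src n k)) q" "occurs_at (D (tgt n k)) (q + length (D (src n k)))"
        using arc[OF k] by blast
      have "?M dvd int q - int (p (src n k))" "?M dvd int (p (tgt n k)) - int (q + length (D (src n k)))"
        using same[OF src_tgt_less(1)[OF k] q(1) p] same[OF src_tgt_less(2)[OF k] p q(2)] src_tgt_less[OF k]
        by blast+
      from dvd_add[OF this] show ?thesis by (simp add: len_def algebra_simps)
    qed
    have next_p: "?M dvd int (p (Suc i)) - int (p i) - len i" if "Suc i < n" for i
      using step[of "2 * i"] that by (simp add: src_def tgt_def)
    \<comment> \<open>An arc followed by its reverse returns to the same start, so neighbouring
      lengths add up to 0 modulo \<open>?M\<close>. Since \<open>2 * len i\<close> is 0 modulo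
      \<open>?M\<close> by the induction hypothesis, the sum may be read as a difference.\<close>
    have next_len: "?M dvd len (Suc i) - len i" if i: "Suc i < n" for i
    proof -
      have "?M dvd int (p i) - int (p (Suc i)) - len (Suc i)"
        using step[of "2 * i + 1"] i by (simp add: src_def tgt_def)
      from dvd_add[OF next_p[OF i] this] have "?M dvd - (len i + len (Suc i))"
        by (simp add: algebra_simps)
      then have "?M dvd len i + len (Suc i)" by (simp only: dvd_minus_iff)
      moreover have "?M dvd 2 * len i" using Suc i by (simp add: len_def)
      ultimately have "?M dvd (len i + len (Suc i)) - 2 * len i" by (rule dvd_diff)
      then show ?thesis by (simp add: algebra_simps)
    qed
    have along: "?M dvd len i - len 0 \<and> ?M dvd int (p i) - int (p 0) - int i * len 0" if "i < n" for i
      using that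
    proof (induction i)
      case (Suc i)
      then have IH: "?M dvd len i - len 0" "?M dvd int (p i) - int (p 0) - int i * len 0" by auto
      have "?M dvd (len (Suc i) - len i) + (len i - len 0)"
        by (rule dvd_add[OF next_len[OF Suc.prems] IH(1)])
      moreover have "?M dvd (int (p (Suc i)) - int (p i) - len i) + (int (p i) - int (p 0) - int i * len 0) + (len i - len 0)"
        by (intro dvd_add next_p[OF Suc.prems] IH)
      ultimately show ?case by (simp add: algebra_simps)
    qed simp
    obtain m where m: "n = Suc m" using n0 by (cases n) auto
    \<comment> \<open>The arc from the last vertex back to 0 closes the cycle. The total shift is
      \<open>n * len 0\<close>, and \<open>n\<close>, being odd, cancels modulo a power of
      two.\<close>
    have "?M dvd int (p 0) - int (p m) - len m"
      using step[of "2 * m"] by (simp add: src_def tgt_def m)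
    moreover have "?M dvd len m - len 0" "?M dvd int (p m) - int (p 0) - int m * len 0"
      using along[of m] m by auto
    ultimately have "?M dvd (int (p 0) - int (p m) - len m) + (len m - len 0) + (int (p m) - int (p 0) - int m * len 0)"
      by (intro dvd_add)
    then have "?M dvd - (int n * len 0)" by (simp add: m algebra_simps)
    then have "?M dvd int n * len 0" by (simp only: dvd_minus_iff)
    moreover have "coprime ?M (int n)" using n by simp
    ultimately have len0: "?M dvd len 0" by (simp add: coprime_dvd_mult_right_iff)
    have len: "?M dvd len i" if "i < n" for i
      using dvd_add[OF len0 along[OF that, THEN conjunct1]] by simp
    have pp: "?M dvd int (p i) - int (p 0)" if "i < n" for i
      using dvd_add[OF along[OF that, THEN conjunct2] dvd_mult[OF len0, of "int i"]] by simp
    have "?M dvd int x - int y" if "i < n" "j < n" "occurs_at (D i) x" "occurs_at (D j) y" for i j x y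
    proof -
      have "?M dvd (int x - int (p i)) + (int (p i) - int (p 0)) - (int (p j) - int (p 0)) - (int y - int (p j))"
        using that by (intro dvd_add dvd_diff pp same[of i] same[of j] p) auto
      then show ?thesis by simp
    qed
    then show ?case using len by (auto simp: len_def)
  qed simp
  \<comment> \<open>With the length itself as exponent, divisibility contradicts that a positive
    number is smaller than its power of two.\<close>
  have "(2 :: int) ^ length (D 0) dvd int (length (D 0))" using inv n0 by blast
  then have "2 ^ length (D 0) dvd length (D 0)" by (metis int_dvd_int_iff of_nat_numeral of_nat_power)
  then have "2 ^ length (D 0) \<le> length (D 0)" using ne n0 by (intro dvd_imp_le) auto
  then show False using less_exp[of "length (D 0)"] by simp
qed

section \<open>The identities attached to the cycles\<close>

definition zigzag :: "nat \<Rightarrow> word" where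
  "zigzag n = interleave 0 (cycle_word n)"

definition zigzag_identity :: "nat \<Rightarrow> identity" where
  "zigzag_identity n = (zigzag n, 0 # 0 # cycle_word n)"

lemma zero_notin_cycle_word: "0 \<notin> set (cycle_word n)"
  using set_cycle_word[of n] by auto

lemma isoterm_zigzag: "2 \<le> n \<Longrightarrow> isoterm brandt_monoid (zigzag n)"
  unfolding zigzag_def by (intro isoterm_interleave isoterm_cycle_word zero_notin_cycle_word)

lemma concat_map_interleave:
  "concat (map g (interleave a c)) = g a @ concat (map (\<lambda>x. g x @ g a) c)"
  by (induction c) auto

text \<open>If the letter 0 is erased, both sides become the image of \<open>cycle_word n\<close>.
  If it is not, the right side contains a square and the left side is outside \<open>L\<close> by
  assumption, so both are zero.\<close>

lemma (in factorial_language) satisfies_zigzag_identity: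
  assumes L: "L \<subseteq> Collect (isoterm brandt_monoid)"
    and g: "\<And>g. g 0 \<noteq> [] \<Longrightarrow> concat (map g (zigzag n)) \<notin> L"
  shows "satisfies (word_monoid L) (zigzag_identity n)"
proof -
  have "concat (map g (zigzag n)) = concat (map g (0 # 0 # cycle_word n))"
    if "concat (map g (zigzag n)) \<in> L \<or> concat (map g (0 # 0 # cycle_word n)) \<in> L" for g
  proof -
    have "g 0 = []"
      using that g square_not_mem[OF L, of "[]" "g 0" "concat (map g (cycle_word n))"] by auto
    then show ?thesis by (simp add: zigzag_def concat_map_interleave)
  qed
  then show ?thesis unfolding zigzag_identity_def satisfies_word_monoid by blast
qed

lemma zimin_factors_isoterms: "zimin_factors \<subseteq> Collect (isoterm brandt_monoid)"
  using isoterm_zimin_factors by blast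

interpretation zimin: factorial_language zimin_factors
  by (rule factorial_zimin_factors)

lemma zimin_satisfies_zigzag_identity:
  assumes "odd n"
  shows "satisfies M_zimin (zigzag_identity n)"
  unfolding M_zimin_eq
proof (rule zimin.satisfies_zigzag_identity[OF zimin_factors_isoterms], rule notI)
  fix g :: "nat \<Rightarrow> word"
  assume g0: "g 0 \<noteq> []" and mem: "concat (map g (zigzag n)) \<in> zimin_factors"
  \<comment> \<open>The trailing \<open>g 0\<close> keeps \<open>D i\<close> nonempty even when
    \<open>vtx i\<close> is erased.\<close>
  define D where "D = (\<lambda>i. g (vtx i) @ g 0)"
  show False
  proof (rule cycle_avoided_by_zimin[OF assms])
    fix k assume k: "k < 2 * n"
    have "[0..<2 * n] = [0..<k] @ k # [Suc k..<2 * n]"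
      using k upt_add_eq_append[of 0 k "2 * n - k"] upt_conv_Cons[OF k] by simp
    then have "\<exists>xs ys. cycle_word n = xs @ [vtx (src n k), vtx (tgt n k), sep k] @ ys"
      unfolding cycle_word_def by (intro exI) simp
    then obtain xs ys where c: "cycle_word n = xs @ [vtx (src n k), vtx (tgt n k), sep k] @ ys"
      by blast
    let ?E = "\<lambda>x. g x @ g 0"
    have "concat (map g (zigzag n)) = (g 0 @ concat (map ?E xs)) @ (D (src n k) @ D (tgt n k)) @
        (?E (sep k) @ concat (map ?E ys))"
      unfolding zigzag_def concat_map_interleave c D_def by simp
    then have "sublist (D (src n k) @ D (tgt n k)) (concat (map g (zigzag n)))"
      unfolding sublist_def by blast
    then show "D (src n k) @ D (tgt n k) \<in> zimin_factors"
      by (rule zimin.sublist_closed[OF mem])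
  qed (simp add: D_def g0)
qed

definition zigzag_factors :: "nat \<Rightarrow> word set" where
  "zigzag_factors n = {u. sublist u (zigzag n)}"

lemma zigzag_factors_isoterms: "2 \<le> n \<Longrightarrow> zigzag_factors n \<subseteq> Collect (isoterm brandt_monoid)"
  using isoterm_sublist[OF monoid_brandt isoterm_zigzag] by (auto simp: zigzag_factors_def)

lemma factorial_zigzag_factors: "2 \<le> n \<Longrightarrow> factorial_language (zigzag_factors n)"
  by (rule factorial_language_isoterms[OF zigzag_factors_isoterms])
    (auto simp: zigzag_factors_def intro: sublist_order.order_trans)

lemma length_zigzag: "length (zigzag n) = 12 * n + 1"
  by (simp add: zigzag_def length_interleave length_cycle_word)

text \<open>Under the identical substitution the left side is in the language, and the two sides
  have the different lengths \<open>12 * n + 1\<close> and \<open>6 * n + 2\<close>.\<close>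

lemma zigzag_identity_fails:
  assumes "2 \<le> n"
  shows "\<not> satisfies (word_monoid (zigzag_factors n)) (zigzag_identity n)"
proof
  interpret factorial_language "zigzag_factors n" by (rule factorial_zigzag_factors[OF assms])
  assume "satisfies (word_monoid (zigzag_factors n)) (zigzag_identity n)"
  then have "zigzag n = 0 # 0 # cycle_word n"
    unfolding zigzag_identity_def satisfies_word_monoid
    by (auto dest!: spec[of _ "\<lambda>x. [x]"] simp: zigzag_factors_def)
  then show False
    using length_zigzag[of n] length_cycle_word[of n] assms by simp
qed

text \<open>Pure counting: if the letter 0 is not erased, the image of \<open>zigzag n\<close> has
  length at least \<open>6 * n\<close>, more than the \<open>12 * m + 1\<close> letters
  available.\<close>

lemma longer_zigzag_identity_holds:
  assumes "2 \<le> m" "2 * m < n"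
  shows "satisfies (word_monoid (zigzag_factors m)) (zigzag_identity n)"
proof -
  interpret factorial_language "zigzag_factors m" by (rule factorial_zigzag_factors[OF assms(1)])
  show ?thesis
  proof (rule satisfies_zigzag_identity[OF zigzag_factors_isoterms[OF assms(1)]], rule notI)
    fix g :: "nat \<Rightarrow> word"
    assume g0: "g 0 \<noteq> []" and mem: "concat (map g (zigzag n)) \<in> zigzag_factors m"
    have "length c \<le> length (concat (map (\<lambda>x. g x @ g 0) c))" for c
      using g0 by (induction c; cases "g 0") auto
    from this[of "cycle_word n"] have "6 * n \<le> length (concat (map g (zigzag n)))"
      unfolding zigzag_def concat_map_interleave by (simp add: length_cycle_word)
    also have "\<dots> \<le> 12 * m + 1"
      using mem sublist_length_le by (fastforce simp: zigzag_factors_def length_zigzag)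
    finally show False using assms(2) by simp
  qed
qed


section \<open>Identities in few letters\<close>

fun join :: "'a list \<Rightarrow> 'a list \<Rightarrow> 'a list list \<Rightarrow> 'a list" where
  "join X (y # ys) (A # As) = X @ y # join A ys As"
| "join X _ _ = X"

lemma join_decomposition:
  "\<exists>X As. u = join X (filter P u) As \<and> length As = length (filter P u) \<and>
    (\<forall>A \<in> set (X # As). \<forall>z \<in> set A. \<not> P z)"
proof (induction u)
  case Nil
  show ?case by (rule exI[of _ "[]"], rule exI[of _ "[]"]) simp
next
  case (Cons z u)
  then obtain X As where u: "u = join X (filter P u) As" "length As = length (filter P u)"
    "\<forall>A \<in> set (X # As). \<forall>z \<in> set A. \<not> P z" by blast
  show ?case
  proof (cases "P z")
    case True
    then show ?thesis using u by (intro exI[of _ "[]"] exI[of _ "X # As"]) simp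
  next
    case False
    have "z # join X ys As = join (z # X) ys As" for ys
      by (cases "(X, ys, As)" rule: join.cases) auto
    then have e: "z # u = join (z # X) (filter P u) As"
      by (rule HOL.trans[OF arg_cong[OF u(1), of "(#) z"]])
    have f: "filter P (z # u) = filter P u" using False by simp
    show ?thesis unfolding f
      by (intro exI[of _ "z # X"] exI[of _ As] conjI e u(2)) (use u(3) False in auto)
  qed
qed

lemma set_join: "set (join X ys As) \<subseteq> set X \<union> set ys \<union> \<Union> (set ` set As)"
  by (induction X ys As rule: join.induct) auto

lemma join_segment_sublist: "length ys = length As \<Longrightarrow> A \<in> set (X # As) \<Longrightarrow> sublist A (join X ys As)"
proof (induction X ys As rule: join.induct)
  case (1 X y ys B As)
  show ?case
  proof (cases "A = X")
    case True
    then show ?thesis by simp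
  next
    case False
    then have "sublist A (join B ys As)" using 1 by simp
    then show ?thesis unfolding sublist_def by (metis append.assoc append_Cons join.simps(1))
  qed
qed auto

lemma append_Cons_eq_split:
  "y \<notin> set X \<Longrightarrow> y \<notin> set Y \<Longrightarrow> X @ y # s = Y @ y # t \<Longrightarrow> X = Y \<and> s = t"
proof (induction X arbitrary: Y)
  case Nil
  then show ?case by (cases Y) auto
next
  case (Cons x X)
  then show ?case by (cases Y) auto
qed

text \<open>The separators \<open>ys\<close> need not be distinct, as those in Zimin words are not.
  Being absent from all segments, they are recognised one after the other from the left.\<close>

lemma join_inject:
  assumes "join X ys As = join Y ys Bs" "length As = length ys" "length Bs = length ys"
    and "\<And>A y. A \<in> set (X # As) \<union> set (Y # Bs) \<Longrightarrow> y \<in> set ys \<Longrightarrow> y \<notin> set A"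
  shows "X = Y \<and> As = Bs"
  using assms
proof (induction ys arbitrary: X Y As Bs)
  case (Cons y ys)
  then obtain A As' B Bs' where AB: "As = A # As'" "Bs = B # Bs'"
    by (metis length_Suc_conv)
  have "y \<notin> set X" "y \<notin> set Y" using Cons.prems(4) by auto
  then have "X = Y \<and> join A ys As' = join B ys Bs'"
    by (rule append_Cons_eq_split) (use Cons.prems(1) AB in simp)
  then have "X = Y" "join A ys As' = join B ys Bs'" by simp_all
  moreover have "A = B \<and> As' = Bs'"
    using Cons.prems AB calculation by (intro Cons.IH) auto
  ultimately show ?case using AB by simp
qed simp

lemma concat_map_join:
  "length ys = length As \<Longrightarrow>
    concat (map g (join X ys As)) = concat (map g X) @
      concat (map2 (\<lambda>y B. g y @ B) ys (map (\<lambda>A. concat (map g A)) As))"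
  by (induction X ys As rule: join.induct) auto

text \<open>The linear letter between two consecutive segments \<open>U\<close>, \<open>U'\<close>
  is sent to \<open>rgt U @ y # lft U'\<close>: it completes the segment before it, places the
  separator, and opens the segment after it. The same \<open>\<beta>'\<close> serves all choices of
  \<open>Ws\<close>, so it can be applied to both sides of an identity.\<close>

lemma linked_substitution:
  fixes \<beta> :: "nat \<Rightarrow> word" and lft rgt :: "word \<Rightarrow> word"
  assumes "distinct ls" "length ys = length ls" "length Us = length ls"
  shows "\<exists>\<beta>'. \<forall>W0 Ws. length Ws = length ls \<longrightarrow> (\<forall>W \<in> set (W0 # Ws). set W \<inter> set ls = {}) \<longrightarrow>
    lft U0 @ concat (map \<beta>' (join W0 ls Ws)) @ rgt (last (U0 # Us)) =
      join (lft U0 @ concat (map \<beta> W0) @ rgt U0) ys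
        (map2 (\<lambda>U W. lft U @ concat (map \<beta> W) @ rgt U) Us Ws)"
proof -
  \<comment> \<open>Agreement with \<open>\<beta>\<close> outside \<open>ls\<close> is carried
    through the induction, so that segments keep their images when further linear letters are
    redefined.\<close>
  have "\<exists>\<beta>'. (\<forall>x. x \<notin> set ls \<longrightarrow> \<beta>' x = \<beta> x) \<and>
    (\<forall>W0 Ws. length Ws = length ls \<longrightarrow> (\<forall>W \<in> set (W0 # Ws). set W \<inter> set ls = {}) \<longrightarrow>
    lft U0 @ concat (map \<beta>' (join W0 ls Ws)) @ rgt (last (U0 # Us)) =
      join (lft U0 @ concat (map \<beta> W0) @ rgt U0) ys
        (map2 (\<lambda>U W. lft U @ concat (map \<beta> W) @ rgt U) Us Ws))"
    using assms
  proof (induction ls arbitrary: U0 ys Us)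
    case Nil
    then show ?case by (intro exI[of _ \<beta>]) simp
  next
    case (Cons l ls)
    then obtain y ys' U Us' where eqs: "ys = y # ys'" "Us = U # Us'"
      by (metis length_Suc_conv)
    have "\<exists>\<beta>'. (\<forall>x. x \<notin> set ls \<longrightarrow> \<beta>' x = \<beta> x) \<and>
      (\<forall>W0 Ws. length Ws = length ls \<longrightarrow> (\<forall>W \<in> set (W0 # Ws). set W \<inter> set ls = {}) \<longrightarrow>
      lft U @ concat (map \<beta>' (join W0 ls Ws)) @ rgt (last (U # Us')) =
        join (lft U @ concat (map \<beta> W0) @ rgt U) ys'
          (map2 (\<lambda>U W. lft U @ concat (map \<beta> W) @ rgt U) Us' Ws))"
      using Cons.prems eqs by (intro Cons.IH) auto
    then obtain \<beta>'' where out: "\<And>x. x \<notin> set ls \<Longrightarrow> \<beta>'' x = \<beta> x"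
      and IH: "\<And>W0 Ws. length Ws = length ls \<Longrightarrow> \<forall>W \<in> set (W0 # Ws). set W \<inter> set ls = {} \<Longrightarrow>
        lft U @ concat (map \<beta>'' (join W0 ls Ws)) @ rgt (last (U # Us')) =
        join (lft U @ concat (map \<beta> W0) @ rgt U) ys'
          (map2 (\<lambda>U W. lft U @ concat (map \<beta> W) @ rgt U) Us' Ws)"
      by blast
    define \<beta>' where "\<beta>' = \<beta>''(l := rgt U0 @ y # lft U)"
    show ?case
    proof (intro exI[of _ \<beta>'] conjI allI impI)
      show "\<beta>' x = \<beta> x" if "x \<notin> set (l # ls)" for x
        using that out by (simp add: \<beta>'_def)
    next
      fix W0 Ws assume len: "length Ws = length (l # ls)"
        and disj: "\<forall>W \<in> set (W0 # Ws). set W \<inter> set (l # ls) = {}"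
      then obtain W Ws' where Ws: "Ws = W # Ws'" by (metis length_Suc_conv)
      have m0: "map \<beta>' W0 = map \<beta> W0"
        using disj out by (auto simp: \<beta>'_def)
      have m1: "map \<beta>' (join W ls Ws') = map \<beta>'' (join W ls Ws')"
      proof -
        have "l \<notin> set (join W ls Ws')"
          using set_join[of W ls Ws'] disj Cons.prems(1) by (auto simp: Ws)
        then show ?thesis by (auto simp: \<beta>'_def)
      qed
      have "concat (map \<beta>' (join W0 (l # ls) Ws)) =
          concat (map \<beta> W0) @ (rgt U0 @ y # lft U) @ concat (map \<beta>'' (join W ls Ws'))"
        unfolding Ws join.simps map_append list.map m0 m1 by (simp add: \<beta>'_def)
      moreover have "lft U @ concat (map \<beta>'' (join W ls Ws')) @ rgt (last (U # Us')) =
        join (lft U @ concat (map \<beta> W) @ rgt U) ys'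
          (map2 (\<lambda>U W. lft U @ concat (map \<beta> W) @ rgt U) Us' Ws')"
        using len disj by (intro IH) (auto simp: Ws)
      ultimately show "lft U0 @ concat (map \<beta>' (join W0 (l # ls) Ws)) @ rgt (last (U0 # Us)) =
        join (lft U0 @ concat (map \<beta> W0) @ rgt U0) ys
          (map2 (\<lambda>U W. lft U @ concat (map \<beta> W) @ rgt U) Us Ws)"
        unfolding Ws eqs by simp
    qed
  qed
  then show ?thesis by blast
qed

lemma zimin_le_sublist: "m \<le> n \<Longrightarrow> sublist (zimin m) (zimin n)"
proof (induction n rule: dec_induct)
  case (step n)
  have "sublist (zimin n) (zimin (Suc n))" by (auto simp: sublist_def intro: exI[of _ "[]"])
  then show ?case using step.IH by (rule sublist_order.order_trans[rotated])
qed simp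

lemma join_append:
  "length ys = length As \<Longrightarrow> join X (ys @ y # ys') (As @ A # As') = join X ys As @ y # join A ys' As'"
  by (induction X ys As rule: join.induct) auto

lemma join_take_prefix:
  "length ys = length As \<Longrightarrow> prefix (join X (take r ys) (take r As)) (join X ys As)"
proof (induction X ys As arbitrary: r rule: join.induct)
  case (1 X y ys A As)
  then show ?case by (cases r) auto
qed auto

lemma zimin_eq_join:
  "\<exists>ys. 2 ^ r = Suc (length ys) \<and> (\<forall>y \<in> set ys. M < y) \<and>
    zimin (M + r) = join (zimin M) ys (replicate (length ys) (zimin M))"
proof (induction r)
  case (Suc r)
  then obtain ys where ys: "2 ^ r = Suc (length ys)" "\<forall>y \<in> set ys. M < y"
    "zimin (M + r) = join (zimin M) ys (replicate (length ys) (zimin M))" by blast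
  have rep: "replicate (length (ys @ Suc (M + r) # ys)) z = replicate (length ys) z @ z # replicate (length ys) z"
    for z :: word
    unfolding length_append list.size replicate_add by (simp add: replicate_append_same)
  have "zimin (M + Suc r) = join (zimin M) (ys @ Suc (M + r) # ys)
      (replicate (length (ys @ Suc (M + r) # ys)) (zimin M))"
    unfolding rep using ys(3) by (simp add: join_append)
  then show ?case
    using ys(1,2) by (intro exI[of _ "ys @ Suc (M + r) # ys"] conjI) auto
qed simp

text \<open>\<open>zimin (M + r)\<close> has \<open>2 ^ r - 1\<close> separators above
  \<open>M\<close>, at least \<open>r\<close>; a prefix with exactly \<open>r\<close> of them is
  taken.\<close>

lemma zimin_factor_join:
  "\<exists>ys. length ys = r \<and> (\<forall>y \<in> set ys. M < y) \<and> join (zimin M) ys (replicate r (zimin M)) \<in> zimin_factors"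
proof -
  obtain ys where ys: "2 ^ r = Suc (length ys)" "\<forall>y \<in> set ys. M < y"
    "zimin (M + r) = join (zimin M) ys (replicate (length ys) (zimin M))" using zimin_eq_join by blast
  have r: "r \<le> length ys" using ys(1) less_exp[of r] by simp
  have "sublist (join (zimin M) (take r ys) (replicate r (zimin M))) (zimin (M + r))"
    using join_take_prefix[of ys "replicate (length ys) (zimin M)" "zimin M" r] r
    by (simp add: ys(3) min_def prefix_imp_sublist)
  then show ?thesis
    using ys(2) r by (intro exI[of _ "take r ys"]) (auto simp: zimin_factors_iff dest: in_set_takeD)
qed

lemma zimin_letters_le: "x \<in> set (zimin M) \<Longrightarrow> x \<le> M"
  by (induction M) auto

lemma M_zimin_satisfies_iff:
  "satisfies M_zimin (u, v) \<longleftrightarrow> (\<forall>g. concat (map g u) \<in> zimin_factors \<or> concat (map g v) \<in> zimin_factors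
    \<longrightarrow> concat (map g u) = concat (map g v))"
  unfolding M_zimin_eq by (rule factorial_language.satisfies_word_monoid[OF factorial_zimin_factors])

lemma M_zimin_satisfiesD:
  "satisfies M_zimin (u, v) \<Longrightarrow> concat (map g u) \<in> zimin_factors \<Longrightarrow> concat (map g v) = concat (map g u)"
  unfolding M_zimin_satisfies_iff by (drule spec[of _ g]) simp

text \<open>
  \<open>u\<close> and \<open>v\<close> are cut into segments at the linear letters \<open>ls\<close>. If all segments of \<open>u\<close> have images in
  \<open>z\<^sub>M\<close>, the linear letters can be chosen so that the image of \<open>u\<close> lies in \<open>z\<^sub>M y z\<^sub>M y' z\<^sub>M \<dots>\<close> with
  each separator \<open>y > M\<close>; equality with the image of \<open>v\<close> can then be read off between the separators.
\<close>

lemma zimin_segments_determined: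
  assumes sat: "satisfies M_zimin (join U0 ls Us, join V0 ls Vs)"
    and len: "length Us = length ls" "length Vs = length ls" and dist: "distinct ls"
    and disj: "\<And>W. W \<in> set (U0 # Us) \<union> set (V0 # Vs) \<Longrightarrow> set W \<inter> set ls = {}"
    and fac: "\<And>U. U \<in> set (U0 # Us) \<Longrightarrow> concat (map \<beta> U) \<in> zimin_factors"
  shows "map (\<lambda>V. concat (map \<beta> V)) (V0 # Vs) = map (\<lambda>U. concat (map \<beta> U)) (U0 # Us)"
proof -
  have "\<forall>U. \<exists>k. U \<in> set (U0 # Us) \<longrightarrow> sublist (concat (map \<beta> U)) (zimin k)"
    using fac unfolding zimin_factors_iff by blast
  then obtain k where k: "\<And>U. U \<in> set (U0 # Us) \<Longrightarrow> sublist (concat (map \<beta> U)) (zimin (k U))" by metis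
  \<comment> \<open>\<open>M\<close> bounds the indices of Zimin words containing the segment images
    of the left side, and also all letters in the segment images of the right side. Hence no
    separator can occur inside a segment on either side.\<close>
  define S where "S = k ` set (U0 # Us) \<union> (\<Union>V \<in> set (V0 # Vs). set (concat (map \<beta> V)))"
  have "finite S" by (simp add: S_def)
  then obtain M where M: "\<And>s. s \<in> S \<Longrightarrow> s \<le> M" using finite_nat_set_iff_bounded_le by auto
  have "sublist (concat (map \<beta> U)) (zimin M)" if "U \<in> set (U0 # Us)" for U
    using k[OF that] zimin_le_sublist[OF M, of "k U"] that sublist_order.order_trans unfolding S_def by blast
  then have "\<forall>U. \<exists>l r. U \<in> set (U0 # Us) \<longrightarrow> l @ concat (map \<beta> U) @ r = zimin M"
    unfolding sublist_def by metis
  then obtain lft rgt where lr: "\<And>U. U \<in> set (U0 # Us) \<Longrightarrow> lft U @ concat (map \<beta> U) @ rgt U = zimin M"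
    by metis
  obtain ys where ys: "length ys = length ls" "\<forall>y \<in> set ys. M < y"
    "join (zimin M) ys (replicate (length ls) (zimin M)) \<in> zimin_factors" using zimin_factor_join by blast
  let ?s = "\<lambda>U W. lft U @ concat (map \<beta> W) @ rgt U"
  obtain \<beta>' where \<beta>': "\<And>W0 Ws. length Ws = length ls \<Longrightarrow> (\<forall>W \<in> set (W0 # Ws). set W \<inter> set ls = {}) \<Longrightarrow>
    lft U0 @ concat (map \<beta>' (join W0 ls Ws)) @ rgt (last (U0 # Us)) =
      join (?s U0 W0) ys (map2 ?s Us Ws)"
    using linked_substitution[OF dist ys(1) len(1), of lft U0 rgt \<beta>] by blast
  have u: "lft U0 @ concat (map \<beta>' (join U0 ls Us)) @ rgt (last (U0 # Us)) = join (?s U0 U0) ys (map2 ?s Us Us)"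
    by (rule \<beta>') (use len disj in auto)
  have v: "lft U0 @ concat (map \<beta>' (join V0 ls Vs)) @ rgt (last (U0 # Us)) = join (?s U0 V0) ys (map2 ?s Us Vs)"
    by (rule \<beta>') (use len disj in auto)
  have "map2 ?s Us Us = map (\<lambda>_. zimin M) Us"
    using lr by (induction Us) auto
  then have UU: "map2 ?s Us Us = replicate (length ls) (zimin M)"
    using len by (simp add: map_replicate_const)
  have "lft U0 @ concat (map \<beta>' (join U0 ls Us)) @ rgt (last (U0 # Us)) \<in> zimin_factors"
    unfolding u UU using lr[of U0] ys(3) by simp
  then have "concat (map \<beta>' (join U0 ls Us)) \<in> zimin_factors"
    by (rule zimin.sublist_closed) (auto simp: sublist_def)
  then have "concat (map \<beta>' (join U0 ls Us)) = concat (map \<beta>' (join V0 ls Vs))"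
    using sat unfolding M_zimin_satisfies_iff by blast
  then have eq: "join (?s U0 V0) ys (map2 ?s Us Vs) = join (?s U0 U0) ys (map2 ?s Us Us)"
    using u v by simp
  have small: "x \<le> M" if "U \<in> set (U0 # Us)" "W \<in> set (U0 # Us) \<union> set (V0 # Vs)" "x \<in> set (?s U W)" for U W x
  proof -
    have "x \<in> set (lft U) \<union> set (rgt U) \<union> set (concat (map \<beta> W))" using that by auto
    moreover have "x \<le> M" if "x \<in> set (lft U) \<union> set (rgt U)"
      using that lr[OF \<open>U \<in> _\<close>] by (intro zimin_letters_le) (metis Un_iff set_append)
    moreover have "x \<le> M" if "x \<in> set (concat (map \<beta> W))"
    proof (cases "W \<in> set (U0 # Us)")
      case True
      then show ?thesis using that lr[OF True] by (intro zimin_letters_le) (metis Un_iff set_append)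
    next
      case False
      then have "x \<in> S" using \<open>W \<in> _\<close> that unfolding S_def by blast
      then show ?thesis by (rule M)
    qed
    ultimately show ?thesis by blast
  qed
  have "?s U0 V0 = ?s U0 U0 \<and> map2 ?s Us Vs = map2 ?s Us Us"
  proof (rule join_inject[OF eq])
    fix A y assume A: "A \<in> set (?s U0 V0 # map2 ?s Us Vs) \<union> set (?s U0 U0 # map2 ?s Us Us)"
      and y: "y \<in> set ys"
    then obtain U W where "U \<in> set (U0 # Us)" "W \<in> set (U0 # Us) \<union> set (V0 # Vs)" "A = ?s U W"
      by (auto dest: set_zip_leftD set_zip_rightD)
    then show "y \<notin> set A" using small y ys(2) by (meson leD)
  qed (use len ys in auto)
  then have "concat (map \<beta> V0) = concat (map \<beta> U0)" "map2 ?s Us Vs = map2 ?s Us Us" by auto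
  moreover have "map (\<lambda>V. concat (map \<beta> V)) Vs = map (\<lambda>U. concat (map \<beta> U)) Us"
    if "map2 ?s Us Vs = map2 ?s Us Us" "length Us = length Vs"
    using that(2,1) by (induction Us Vs rule: list_induct2) auto
  ultimately show ?thesis using len by simp
qed

text \<open>The empty word is a nonzero value: erasing all letters of \<open>u\<close> must erase
  \<open>v\<close>.\<close>

lemma zimin_content:
  assumes "satisfies M_zimin (u, v)"
  shows "set v \<subseteq> set u"
proof
  fix y assume y: "y \<in> set v"
  show "y \<in> set u"
  proof (rule ccontr)
    assume "y \<notin> set u"
    let ?g = "\<lambda>z. if z = y then [0 :: nat] else []"
    have u: "concat (map ?g u) = []" using \<open>y \<notin> set u\<close> by auto
    have "concat (map ?g u) \<in> zimin_factors" unfolding u by (rule zimin.Nil_mem)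
    from M_zimin_satisfiesD[OF assms this] have "concat (map ?g v) = []" unfolding u .
    then show False using y by auto
  qed
qed

text \<open>Sending two linear letters to 0 and 1 and erasing the rest maps \<open>u\<close> to a
  word of length at most 2 that is a factor of the limit word, so the order of the two letters and
  their number in \<open>v\<close> are forced.\<close>

lemma zimin_linear_letters:
  assumes sat: "satisfies M_zimin (u, v)"
  shows "filter (\<lambda>z. count_list u z = 1) u = filter (\<lambda>z. count_list u z = 1) v" (is "filter ?P u = _")
proof (rule filter_pairs_eqI)
  fix x y assume "x \<in> set (filter ?P u) \<union> set (filter ?P v)" "y \<in> set (filter ?P u) \<union> set (filter ?P v)"
  then have xy: "count_list u x = 1" "count_list u y = 1" by auto
  let ?Q = "\<lambda>z. z = x \<or> z = y"
  let ?h = "\<lambda>z. if z = x then 0 else 1 :: nat"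
  have cl: "count_list (filter ?Q u) z = (if ?Q z then count_list u z else 0)" for z
    by (induction u) auto
  have "sum (count_list (filter ?Q u)) {x, y} = length (filter ?Q u)"
    by (rule sum_count_set) auto
  then have len: "length (filter ?Q u) = card {x, y}" using xy cl[of x] cl[of y] by (cases "x = y") simp_all
  have sub: "set (filter ?Q u) \<subseteq> {x, y}" by auto
  have "map ?h (filter ?Q u) \<in> {[0], [0, 1], [1, 0]}"
  proof (cases "x = y")
    case True
    then obtain a where a: "filter ?Q u = [a]" using len by (auto simp: length_Suc_conv)
    have "a = x" using sub True unfolding a by simp
    then show ?thesis unfolding a by simp
  next
    case False
    then obtain a b where ab: "filter ?Q u = [a, b]"
      using len by (auto simp: numeral_2_eq_2 length_Suc_conv)
    have "count_list [a, b] x = 1" "count_list [a, b] y = 1"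
      unfolding ab[symmetric] cl using xy by simp_all
    then show ?thesis unfolding ab using False by (auto split: if_splits)
  qed
  moreover have "[0] \<in> zimin_factors" "[0, 1] \<in> zimin_factors" "[1, 0] \<in> zimin_factors"
    unfolding zimin_factors_iff
    by (rule exI[of _ 1], simp add: sublist_code)+
  moreover have im: "concat (map (\<lambda>z. if ?Q z then [?h z] else []) w) = map ?h (filter ?Q w)" for w
    by (induction w) auto
  ultimately have "map ?h (filter ?Q u) = map ?h (filter ?Q v)"
    using M_zimin_satisfiesD[OF sat, of "\<lambda>z. if ?Q z then [?h z] else []"]
    unfolding im by auto
  then have "filter ?Q u = filter ?Q v"
    by (rule map_inj_on) (auto simp: inj_on_def)
  moreover have "filter ?Q (filter ?P w) = filter ?Q w" for w
    using xy by (auto intro!: filter_cong)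
  ultimately show "filter ?Q (filter ?P u) = filter ?Q (filter ?P v)" by simp
qed

section \<open>Factors of the zigzag words\<close>

definition zigzag_letter :: "nat \<Rightarrow> nat \<Rightarrow> nat" where
  "zigzag_letter n j = (if even j then 0 else if j mod 6 = 5 then sep (j div 6)
    else if j mod 6 = 1 then vtx (src n (j div 6)) else vtx (tgt n (j div 6)))"

lemma zigzag_letter_block:
  "zigzag_letter n (6 * k) = 0" "zigzag_letter n (6 * k + 1) = vtx (src n k)"
  "zigzag_letter n (6 * k + 2) = 0" "zigzag_letter n (6 * k + 3) = vtx (tgt n k)"
  "zigzag_letter n (6 * k + 4) = 0" "zigzag_letter n (6 * k + 5) = sep k"
proof -
  have "(6 * k + r) mod 6 = r \<and> (6 * k + r) div 6 = k" if "r < 6" for r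
    using that by simp
  from this[of 1] this[of 3] this[of 5]
  show "zigzag_letter n (6 * k) = 0" "zigzag_letter n (6 * k + 1) = vtx (src n k)"
    "zigzag_letter n (6 * k + 2) = 0" "zigzag_letter n (6 * k + 3) = vtx (tgt n k)"
    "zigzag_letter n (6 * k + 4) = 0" "zigzag_letter n (6 * k + 5) = sep k"
    unfolding zigzag_letter_def by simp_all
qed

lemma zigzag_letter_eq_0: "zigzag_letter n j = 0 \<longleftrightarrow> even j"
  by (auto simp: zigzag_letter_def vtx_def sep_def)

lemma zigzag_letter_eq_sep: "zigzag_letter n j = sep k \<longleftrightarrow> j = 6 * k + 5"
proof
  assume a: "zigzag_letter n j = sep k"
  then have "j mod 6 = 5" by (auto simp: zigzag_letter_def split: if_splits)
  moreover then have "j div 6 = k" using a by (auto simp: zigzag_letter_def split: if_splits)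
  ultimately show "j = 6 * k + 5" using mult_div_mod_eq[of 6 j] by simp
qed (simp add: zigzag_letter_block)

lemma zigzag_letter_vtx_cases:
  assumes "zigzag_letter n j = vtx i"
  obtains k where "j = 6 * k + 1" "i = src n k" | k where "j = 6 * k + 3" "i = tgt n k"
proof -
  have "odd j" using assms zigzag_letter_eq_0[of n j] by auto
  then have "j mod 6 = 1 \<or> j mod 6 = 3 \<or> j mod 6 = 5" by presburger
  then obtain k where "j = 6 * k + 1 \<or> j = 6 * k + 3 \<or> j = 6 * k + 5"
    by (metis mult_div_mod_eq)
  then show thesis using that assms zigzag_letter_block[of n k] by auto
qed

lemma zigzag_eq_map: "zigzag n = map (zigzag_letter n) [0..<12 * n + 1]"
proof -
  have "interleave 0 (concat (map (\<lambda>k. [vtx (src n k), vtx (tgt n k), sep k]) [0..<K])) =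
      map (zigzag_letter n) [0..<6 * K + 1]" for K
  proof (induction K)
    case 0
    show ?case by (simp add: zigzag_letter_def)
  next
    case (Suc K)
    have "[0..<6 * Suc K + 1] = [0..<6 * K + 1] @ [6 * K + 1, 6 * K + 2, 6 * K + 3, 6 * K + 4, 6 * K + 5, 6 * Suc K]"
      by (simp add: upt_rec[of "6 * K + _"] numeral_eq_Suc)
    then have "map (zigzag_letter n) [0..<6 * Suc K + 1] = map (zigzag_letter n) [0..<6 * K + 1] @
        [vtx (src n K), 0, vtx (tgt n K), 0, sep K, 0]"
      by (simp only: map_append list.map zigzag_letter_block)
    then show ?case using Suc by (simp add: interleave_append)
  qed
  from this[of "2 * n"] show ?thesis by (simp add: zigzag_def cycle_word_def)
qed

lemma zigzag_nth: "j < 12 * n + 1 \<Longrightarrow> zigzag n ! j = zigzag_letter n j"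
  unfolding zigzag_eq_map by (subst nth_map) (simp_all del: upt_Suc)

text \<open>From \<open>n = 3\<close> on the cycle has no parallel edges: two steps forward never
  return to the start, so an arc in forward orientation differs from every one in backward
  orientation.\<close>

lemma arc_inject:
  assumes n: "3 \<le> n" and k: "k < 2 * n" "k' < 2 * n"
    and eq: "src n k = src n k'" "tgt n k = tgt n k'"
  shows "k = k'"
proof -
  have two: "i \<noteq> Suc (Suc i mod n) mod n" if "i < n" for i
  proof (cases "Suc i < n")
    case True
    then show ?thesis using n by (cases "Suc (Suc i) = n") auto
  next
    case False
    then have "Suc i = n" using that by simp
    then show ?thesis using n by simp
  qed
  have "k div 2 < n" "k' div 2 < n" using k by auto
  then have "even k \<longleftrightarrow> even k'"
    using eq two[of "k div 2"] two[of "k' div 2"] by (auto simp: src_def tgt_def split: if_splits)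
  moreover then have "k div 2 = k' div 2"
    using eq by (auto simp: src_def tgt_def split: if_splits)
  ultimately show ?thesis by presburger
qed

text \<open>Separators occur once, so a factor occurring twice contains none. Two different vertex
  letters in it would be the source and target of one block in either occurrence; an arc is
  determined by its ends, so the two occurrences would coincide.\<close>

lemma zigzag_repeated_factor:
  assumes n: "3 \<le> n" and rep: "zigzag n = X @ U @ Y @ U @ Z"
  shows "\<exists>i. set U \<subseteq> {0, vtx i}"
proof (cases "U = []")
  case False
  define p where "p = length X"
  define q where "q = length X + length U + length Y"
  have pq: "p < q" using False by (simp add: p_def q_def)
  have len: "q + length U \<le> 12 * n + 1"
    using arg_cong[OF rep, of length] by (simp add: length_zigzag q_def)
  have P: "U ! j = zigzag_letter n (p + j)" and Q: "U ! j = zigzag_letter n (q + j)" if j: "j < length U" for j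
  proof -
    have "zigzag n ! (p + j) = U ! j" unfolding rep p_def using j by (simp add: nth_append)
    then show "U ! j = zigzag_letter n (p + j)" using zigzag_nth[of "p + j" n] j len pq by simp
    have "zigzag n ! (q + j) = U ! j" unfolding rep q_def using j by (simp add: nth_append)
    then show "U ! j = zigzag_letter n (q + j)" using zigzag_nth[of "q + j" n] j len by simp
  qed
  have nosep: "U ! j \<noteq> sep k" if "j < length U" for j k
    using P[OF that] Q[OF that] pq zigzag_letter_eq_sep by (metis add_right_cancel nat_neq_iff)
  have uniq: "i = i'" if "j < length U" "j' < length U" "U ! j = vtx i" "U ! j' = vtx i'" "j \<le> j'" for i i' j j'
  proof (rule ccontr)
    assume ii: "i \<noteq> i'"
    have between: "\<not> (p + j < 6 * k + 5 \<and> 6 * k + 5 < p + j')" for k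
    proof
      assume k: "p + j < 6 * k + 5 \<and> 6 * k + 5 < p + j'"
      then have l: "6 * k + 5 - p < length U" "p + (6 * k + 5 - p) = 6 * k + 5" using that(2) by linarith+
      then have "U ! (6 * k + 5 - p) = sep k"
        using P[OF l(1)] unfolding l(2) zigzag_letter_block by simp
      then show False using nosep[OF l(1)] by simp
    qed
    have "zigzag_letter n (p + j) = vtx i" using P that by simp
    then obtain k where k: "p + j = 6 * k + 1 \<and> i = src n k \<or> p + j = 6 * k + 3 \<and> i = tgt n k"
      by (elim zigzag_letter_vtx_cases) auto
    have "zigzag_letter n (p + j') = vtx i'" using P that by simp
    then obtain k' where k': "p + j' = 6 * k' + 1 \<and> i' = src n k' \<or> p + j' = 6 * k' + 3 \<and> i' = tgt n k'"
      by (elim zigzag_letter_vtx_cases) auto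
    have "k = k'" using between[of k] k k' that(5) by linarith
    then have kk: "p + j = 6 * k + 1" "i = src n k" "p + j' = 6 * k + 3" "i' = tgt n k"
      using k k' ii that(5) by auto
    \<comment> \<open>Vertex letters two positions apart also share a block at the second
      occurrence, because a separator position follows each target.\<close>
    then have j': "j' = j + 2" by simp
    have "zigzag_letter n (q + j) = vtx i" using Q that by simp
    then obtain l where l: "q + j = 6 * l + 1 \<and> i = src n l \<or> q + j = 6 * l + 3 \<and> i = tgt n l"
      by (elim zigzag_letter_vtx_cases) auto
    have "zigzag_letter n (q + j') = vtx i'" using Q that by simp
    then obtain l' where l': "q + j' = 6 * l' + 1 \<and> i' = src n l' \<or> q + j' = 6 * l' + 3 \<and> i' = tgt n l'"
      by (elim zigzag_letter_vtx_cases) auto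
    have ll: "q + j = 6 * l + 1 \<and> i = src n l" "i' = tgt n l"
      using l l' j' by (auto; presburger)+
    have "k < 2 * n" "l < 2 * n" using kk ll len pq that(1,2) j' by linarith+
    then have "k = l" using arc_inject[OF n] kk ll by metis
    then show False using kk ll pq by linarith
  qed
  have letters: "z = 0 \<or> (\<exists>i. z = vtx i)" if "z \<in> set U" for z
  proof -
    obtain j where j: "j < length U" "z = U ! j" using \<open>z \<in> set U\<close> by (auto simp: in_set_conv_nth)
    then show ?thesis using P[OF j(1)] nosep[OF j(1)] by (auto simp: zigzag_letter_def split: if_splits)
  qed
  show ?thesis
  proof (cases "\<exists>i. vtx i \<in> set U")
    case True
    then obtain i where i: "vtx i \<in> set U" by blast
    have "i' = i" if "vtx i' \<in> set U" for i'
    proof -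
      obtain j j' where "j < length U" "vtx i = U ! j" "j' < length U" "vtx i' = U ! j'"
        using i \<open>vtx i' \<in> set U\<close> by (auto simp: in_set_conv_nth)
      then show ?thesis using uniq[of j j' i i'] uniq[of j' j i' i] nat_le_linear[of j j'] by auto
    qed
    then show ?thesis using letters by blast
  next
    case False
    then show ?thesis using letters by blast
  qed
qed simp

text \<open>A proper 2-colouring of the path left over when the vertex \<open>m\<close> of the odd cycle is removed.\<close>

definition side :: "nat \<Rightarrow> nat \<Rightarrow> bool" where
  "side m i \<longleftrightarrow> (if i < m then even i else odd i)"

text \<open>The parity of the vertex alternates along all edges except the closing one, whose ends
  \<open>n - 1\<close> and 0 are both even. Switching the rule beyond \<open>m\<close> repairs this
  edge, at the cost of edges at \<open>m\<close> only.\<close>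

lemma side_alternates:
  assumes n: "odd n" "m < n" and k: "k < 2 * n" and ne: "src n k \<noteq> m" "tgt n k \<noteq> m"
  shows "side m (src n k) \<noteq> side m (tgt n k)"
proof -
  have "side m i \<noteq> side m (Suc i mod n)" if i: "i < n" "i \<noteq> m" "Suc i mod n \<noteq> m" for i
  proof (cases "Suc i = n")
    case True
    then show ?thesis using n i by (auto simp: side_def)
  next
    case False
    then show ?thesis using i by (auto simp: side_def)
  qed
  from this[of "k div 2"] show ?thesis
    using k ne by (auto simp: src_def tgt_def split: if_splits)
qed

text \<open>
  One colour class is collapsed to a single letter, which turns every block into a factor of the
  limit word; applied to both colourings, this loses no information.
\<close>

definition collapse :: "(nat \<Rightarrow> bool) \<Rightarrow> nat \<Rightarrow> nat" where
  "collapse b z = (if z = 0 then 0 else if b ((z - 1) div 2) then 1 else (z - 1) div 2 + 2)"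

lemma collapse_simps [simp]:
  "collapse b 0 = 0" "collapse b (vtx i) = (if b i then 1 else i + 2)"
  by (simp_all add: collapse_def vtx_def)

text \<open>The letter \<open>c\<close> is surrounded by copies of the preceding Zimin word, which
  for \<open>c\<close> at least 2 begins and ends with \<open>0 1 0\<close>.\<close>

lemma zimin_short_factors:
  assumes "2 \<le> c"
  shows "[0, 1, 0, c, 0] \<in> zimin_factors" "[0, c, 0, 1, 0] \<in> zimin_factors"
proof -
  have ends: "(\<exists>s. zimin (Suc k) = [0, 1, 0] @ s) \<and> (\<exists>s. zimin (Suc k) = s @ [0, 1, 0])" for k
  proof (induction k)
    case (Suc k)
    then obtain s s' where s: "zimin (Suc k) = [0, 1, 0] @ s" "zimin (Suc k) = s' @ [0, 1, 0]" by blast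
    have z: "zimin (Suc (Suc k)) = zimin (Suc k) @ [Suc (Suc k)] @ zimin (Suc k)" by simp
    have "zimin (Suc (Suc k)) = [0, 1, 0] @ (s @ [Suc (Suc k)] @ zimin (Suc k))"
      unfolding z by (subst s(1)) simp
    moreover have "zimin (Suc (Suc k)) = (zimin (Suc k) @ [Suc (Suc k)] @ s') @ [0, 1, 0]"
      unfolding z by (subst (2) s(2)) simp
    ultimately show ?case by blast
  qed simp
  obtain k where k: "c = Suc (Suc k)" using assms by (metis Suc_le_D numeral_2_eq_2 Suc_le_mono)
  obtain s s' where s: "zimin (Suc k) = [0, 1, 0] @ s" "zimin (Suc k) = s' @ [0, 1, 0]" using ends by blast
  have z: "zimin c = zimin (Suc k) @ [c] @ zimin (Suc k)" by (simp add: k)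
  have "zimin c = s' @ [0, 1, 0, c, 0] @ (1 # 0 # s)"
    unfolding z by (subst (2) s(1), subst s(2)) simp
  then show "[0, 1, 0, c, 0] \<in> zimin_factors" unfolding zimin_factors_iff sublist_def by blast
  have "zimin c = (s' @ [0, 1]) @ [0, c, 0, 1, 0] @ s"
    unfolding z by (subst (2) s(1), subst s(2)) simp
  then show "[0, c, 0, 1, 0] \<in> zimin_factors" unfolding zimin_factors_iff sublist_def by blast
qed

lemma zimin_factor_0c0:
  assumes "1 \<le> c"
  shows "[0, c, 0] \<in> zimin_factors"
proof (cases "c = 1")
  case True
  have "sublist [0, 1, 0] [0, 1, 0, 2, 0 :: nat]" by (simp add: sublist_code)
  then show ?thesis using True zimin.sublist_closed zimin_short_factors(1)[of 2] by simp
next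
  case False
  have "sublist [0, c, 0] [0, c, 0, 1, 0]" by (simp add: sublist_code)
  then show ?thesis using False assms zimin.sublist_closed zimin_short_factors(2)[of c] by simp
qed

text \<open>Without separators, \<open>U\<close> stays within one block \<open>0 s 0 t 0\<close>. If
  \<open>m\<close> is an end of the arc, \<open>U\<close> lies in \<open>0 b 0\<close> for the other
  end; otherwise the ends have different colours and exactly one of them becomes the letter
  1.\<close>

lemma collapse_zigzag_factor:
  assumes n: "odd n" "3 \<le> n" and m: "m < n"
    and U: "sublist U (zigzag n)" "\<And>z. z \<in> set U \<Longrightarrow> \<not> is_sep z" "vtx m \<notin> set U"
    and b: "b = side m \<or> b = (\<lambda>i. \<not> side m i)"
  shows "map (collapse b) U \<in> zimin_factors"
proof -
  have via: "map (collapse b) U \<in> zimin_factors" if "sublist U V" "map (collapse b) V \<in> zimin_factors" for V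
    using zimin.sublist_closed[OF that(2)] map_mono_sublist[OF that(1)] by blast
  have one: "map (collapse b) [0, vtx i, 0] \<in> zimin_factors" for i
    using zimin_factor_0c0 by simp
  have empty: "map (collapse b) U \<in> zimin_factors" if "sublist U [0]"
    by (rule via[OF that]) (simp add: zimin_factors_iff exI[of _ 0])
  obtain X Y where XY: "zigzag n = X @ U @ Y" using U(1) by (auto simp: sublist_def)
  define p where "p = length X"
  have len: "p + length U \<le> 12 * n + 1"
    using arg_cong[OF XY, of length] by (simp add: length_zigzag p_def)
  have P: "U ! j = zigzag_letter n (p + j)" if "j < length U" for j
  proof -
    have "zigzag n ! (p + j) = U ! j" unfolding XY p_def using that by (simp add: nth_append)
    then show ?thesis using zigzag_nth[of "p + j" n] that len by simp
  qed
  have Ueq: "U = map (zigzag_letter n) [p..<p + length U]"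
    by (rule nth_equalityI) (simp_all add: P)
  define k where "k = p div 6"
  have kp: "6 * k \<le> p" "p \<le> 6 * k + 5" unfolding k_def by presburger+
  have "p + length U \<le> 6 * k + 5 \<or> length U = 0"
  proof (rule ccontr)
    assume a: "\<not> ?thesis"
    then have j: "6 * k + 5 - p < length U" using kp by linarith
    then have "U ! (6 * k + 5 - p) = sep k" using P[OF j] kp by (simp add: zigzag_letter_block)
    then show False using U(2)[OF nth_mem[OF j]] by simp
  qed
  \<comment> \<open>The last alternative is the final letter 0, which follows all
    \<open>2 * n\<close> blocks.\<close>
  then consider "U = []" | "p + length U \<le> 6 * k + 5" "k < 2 * n" | "k \<ge> 2 * n" by force
  then show ?thesis
  proof cases
    case 1
    then show ?thesis using zimin.Nil_mem by simp
  next
    case 2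
    let ?s = "src n k" and ?t = "tgt n k"
    have "sublist U (map (zigzag_letter n) [6 * k..<6 * k + 5])"
      using Ueq kp 2 by (metis sublist_map_upt le_add1)
    also have "[6 * k..<6 * k + 5] = [6 * k, 6 * k + 1, 6 * k + 2, 6 * k + 3, 6 * k + 4]"
      by (simp add: upt_rec[of "6 * k + _"] upt_rec[of "6 * k"] numeral_eq_Suc)
    also have "map (zigzag_letter n) \<dots> = [0, vtx ?s, 0, vtx ?t, 0]"
      by (simp only: list.map zigzag_letter_block)
    finally have sub: "sublist U [0, vtx ?s, 0, vtx ?t, 0]" .
    have st: "?s \<noteq> ?t" using src_neq_tgt[of n k] n 2 by simp
    consider "?s = m" | "?t = m" | "?s \<noteq> m" "?t \<noteq> m" by blast
    then show ?thesis
    proof cases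
      case 1
      then have "sublist U [0, vtx ?t, 0]"
        using sub U(3) by (auto simp: sublist_Cons_right prefix_Cons)
      then show ?thesis by (rule via[OF _ one])
    next
      case 2
      then have "sublist U [0, vtx ?s, 0]"
        using sub U(3) by (auto simp: sublist_Cons_right prefix_Cons)
      then show ?thesis by (rule via[OF _ one])
    next
      case 3
      then have "b ?s \<noteq> b ?t" using side_alternates[OF n(1) m \<open>k < 2 * n\<close>] b by auto
      then have "map (collapse b) [0, vtx ?s, 0, vtx ?t, 0] \<in> zimin_factors"
        using zimin_short_factors by auto
      then show ?thesis by (rule via[OF sub])
    qed
  next
    case 3
    then have "12 * n \<le> p" using kp by linarith
    then have "length U = 0 \<or> p = 12 * n \<and> length U = 1" using len by linarith
    then have "U = [] \<or> p = 12 * n \<and> length U = 1" by simp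
    then have "U = [] \<or> U = [0]"
    proof
      assume a: "p = 12 * n \<and> length U = 1"
      then have "U = [zigzag_letter n p]" by (subst Ueq) simp
      then show ?thesis using a zigzag_letter_eq_0[of n p] by simp
    qed simp
    then show ?thesis by (intro empty) auto
  qed
qed

section \<open>From the limit word to the zigzag words\<close>

lemma map_pair_inject:
  assumes "map c xs = map c ys" "map d xs = map d ys" "set xs \<subseteq> S" "set ys \<subseteq> S"
    and "\<And>x y. x \<in> S \<Longrightarrow> y \<in> S \<Longrightarrow> c x = c y \<Longrightarrow> d x = d y \<Longrightarrow> x = y"
  shows "xs = ys"
proof -
  have "length xs = length ys" using assms(1) by (rule map_eq_imp_length_eq)
  then show ?thesis using assms(1-4)
    by (induction xs ys rule: list_induct2) (auto intro: assms(5))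
qed

lemma distinct_filter_count_list_1: "distinct (filter (\<lambda>z. count_list u z = 1) u)"
proof -
  have d: "distinct xs" if "\<And>z. z \<in> set xs \<Longrightarrow> count_list xs z \<le> 1" for xs :: "'x list"
    using that
  proof (induction xs)
    case (Cons a xs)
    then have "count_list xs a = 0" using Cons.prems[of a] by simp
    then have "a \<notin> set xs" by (simp add: count_list_0_iff)
    moreover have "distinct xs"
    proof (rule Cons.IH)
      show "count_list xs z \<le> 1" if "z \<in> set xs" for z
        using Cons.prems[of z] that by (auto split: if_splits)
    qed
    ultimately show ?case by simp
  qed simp
  have "count_list (filter P u) z \<le> count_list u z" for P z by (induction u) auto
  then show ?thesis by (intro d) (metis (mono_tags, lifting) filter_set mem_Collect_eq set_filter)
qed

lemma nonlinear_split:
  assumes "y \<in> set u" "count_list u y \<noteq> 1"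
  shows "\<exists>a b c. u = a @ y # b @ y # c"
proof -
  obtain a r where u: "u = a @ y # r" "y \<notin> set a" using split_list_first[OF assms(1)] by blast
  then have "count_list r y \<noteq> 0" using assms(2) by (auto simp: count_list_0_iff)
  then have "y \<in> set r" by (simp add: count_list_0_iff)
  then obtain b c where "r = b @ y # c" using split_list by fast
  then show ?thesis using u by blast
qed

lemma sublist_concat_map: "sublist u v \<Longrightarrow> sublist (concat (map g u)) (concat (map g v))"
  by (auto simp: sublist_def) blast

text \<open>Linear letters may have arbitrary images, so only the segments between them are
  compared. The images of the segments avoid separators and \<open>vtx m\<close>, hence both
  collapses bring the segments of \<open>u\<close> into the limit word, where
  \<open>zimin_segments_determined\<close> applies.\<close>

lemma few_letters_image_determined:
  assumes n: "odd n" "3 \<le> n" and sat: "satisfies M_zimin (u, v)" and few: "card (set u) < n"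
    and g: "sublist (concat (map g u)) (zigzag n)"
  shows "concat (map g v) = concat (map g u)"
proof -
  define P where "P = (\<lambda>z. count_list u z = 1)"
  define ls where "ls = filter P u"
  define img where "img = (\<lambda>U. concat (map g U))"
  have ls_v: "filter P v = ls" using zimin_linear_letters[OF sat] by (simp add: ls_def P_def)
  have vu: "set v \<subseteq> set u" by (rule zimin_content[OF sat])
  obtain U0 Us where u: "u = join U0 ls Us" and lenU: "length Us = length ls"
    and UP: "\<forall>U \<in> set (U0 # Us). \<forall>z \<in> set U. \<not> P z"
    using join_decomposition[of u P] unfolding ls_def by blast
  obtain V0 Vs where v: "v = join V0 ls Vs" and lenV: "length Vs = length ls"
    and VP: "\<forall>V \<in> set (V0 # Vs). \<forall>z \<in> set V. \<not> P z"
    using join_decomposition[of v P] unfolding ls_v by blast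
  have subU: "sublist U u" if "U \<in> set (U0 # Us)" for U
    using join_segment_sublist[OF lenU[symmetric] that] u by simp
  have subV: "sublist V v" if "V \<in> set (V0 # Vs)" for V
    using join_segment_sublist[OF lenV[symmetric] that] v by simp
  obtain X Y where XY: "zigzag n = X @ concat (map g u) @ Y" using g by (auto simp: sublist_def)
  have "\<exists>i. set (g y) \<subseteq> {0, vtx i}" if y: "y \<in> set u" "\<not> P y" for y
  proof -
    obtain a b c where "u = a @ y # b @ y # c" using nonlinear_split[OF y(1)] y(2) by (auto simp: P_def)
    then have "zigzag n = (X @ concat (map g a)) @ g y @ concat (map g b) @ g y @ (concat (map g c) @ Y)"
      using XY by simp
    then show ?thesis by (rule zigzag_repeated_factor[OF n(2)])
  qed
  then obtain \<iota> where \<iota>: "\<And>y. y \<in> set u \<Longrightarrow> \<not> P y \<Longrightarrow> set (g y) \<subseteq> {0, vtx (\<iota> y)}" by metis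
  have "\<not> {..<n} \<subseteq> \<iota> ` set u"
  proof
    assume "{..<n} \<subseteq> \<iota> ` set u"
    then have "n \<le> card (\<iota> ` set u)" using card_mono[of "\<iota> ` set u" "{..<n}"] by simp
    also have "\<dots> \<le> card (set u)" by (rule card_image_le) simp
    finally show False using few by simp
  qed
  then obtain m where m: "m < n" "m \<notin> \<iota> ` set u" by auto
  \<comment> \<open>The letters possible in the image of a repeated letter, for the vertex
    \<open>m\<close> that no such image uses.\<close>
  let ?S = "insert 0 (vtx ` (UNIV - {m}))"
  have imgS: "set (img W) \<subseteq> ?S" if "set W \<subseteq> set u" "\<forall>z \<in> set W. \<not> P z" for W
  proof -
    have "set (g z) \<subseteq> ?S" if "z \<in> set W" for z
    proof -
      have "z \<in> set u" "\<not> P z" using that \<open>set W \<subseteq> set u\<close> \<open>\<forall>z \<in> set W. \<not> P z\<close> by auto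
      then have "set (g z) \<subseteq> {0, vtx (\<iota> z)}" "\<iota> z \<noteq> m" using \<iota> m(2) by auto
      then show ?thesis by auto
    qed
    then show ?thesis by (auto simp: img_def)
  qed
  have US: "set (img U) \<subseteq> ?S" if "U \<in> set (U0 # Us)" for U
    by (rule imgS) (use that UP subU[OF that] in \<open>auto dest: set_mono_sublist\<close>)
  have VS: "set (img V) \<subseteq> ?S" if "V \<in> set (V0 # Vs)" for V
    by (rule imgS) (use that VP vu subV[OF that] in \<open>auto dest: set_mono_sublist\<close>)
  have det: "map (map (collapse b)) (map img (V0 # Vs)) = map (map (collapse b)) (map img (U0 # Us))"
    if b: "b = side m \<or> b = (\<lambda>i. \<not> side m i)" for b
  proof -
    define \<beta> where "\<beta> = (\<lambda>z. map (collapse b) (g z))"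
    have \<beta>: "concat (map \<beta> W) = map (collapse b) (img W)" for W
      by (induction W) (auto simp: \<beta>_def img_def)
    have "map (\<lambda>V. concat (map \<beta> V)) (V0 # Vs) = map (\<lambda>U. concat (map \<beta> U)) (U0 # Us)"
    proof (rule zimin_segments_determined)
      show "satisfies M_zimin (join U0 ls Us, join V0 ls Vs)" using sat u v by simp
      show "distinct ls" unfolding ls_def P_def by (rule distinct_filter_count_list_1)
      show "set W \<inter> set ls = {}" if "W \<in> set (U0 # Us) \<union> set (V0 # Vs)" for W
        using that UP VP unfolding ls_def by (auto simp del: set_simps)
      show "concat (map \<beta> U) \<in> zimin_factors" if U: "U \<in> set (U0 # Us)" for U
        unfolding \<beta>
      proof (rule collapse_zigzag_factor[OF n m(1) _ _ _ b])
        show "sublist (img U) (zigzag n)"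
          unfolding img_def using sublist_concat_map[OF subU[OF U]] g by (rule sublist_order.order_trans)
        show "\<not> is_sep z" if "z \<in> set (img U)" for z
          using US[OF U] that by (auto simp: is_sep_def)
        show "vtx m \<notin> set (img U)" using US[OF U] by auto
      qed
    qed (use lenU lenV in auto)
    then show ?thesis by (simp only: \<beta> map_map comp_def)
  qed
  \<comment> \<open>The two collapses use complementary colour classes, so exactly one of them sends
    \<open>vtx i\<close> to \<open>i + 2\<close>: together they are injective on \<open>?S\<close>,
    hence on words over \<open>?S\<close>.\<close>
  have "map img (V0 # Vs) = map img (U0 # Us)"
  proof (rule map_pair_inject[OF det det, of "side m" "\<lambda>i. \<not> side m i" "lists ?S"])
    show "set (map img (V0 # Vs)) \<subseteq> lists ?S" using VS by auto
    show "set (map img (U0 # Us)) \<subseteq> lists ?S" using US by auto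
    fix A B assume AB: "A \<in> lists ?S" "B \<in> lists ?S" "map (collapse (side m)) A = map (collapse (side m)) B"
      "map (collapse (\<lambda>i. \<not> side m i)) A = map (collapse (\<lambda>i. \<not> side m i)) B"
    show "A = B"
    proof (rule map_pair_inject[OF AB(3,4)])
      show "x = y" if "x \<in> ?S" "y \<in> ?S" "collapse (side m) x = collapse (side m) y"
        "collapse (\<lambda>i. \<not> side m i) x = collapse (\<lambda>i. \<not> side m i) y" for x y
        using that by (auto split: if_splits)
    qed (use AB(1,2) in auto)
  qed simp_all
  then have "img V0 = img U0" "map img Vs = map img Us" by auto
  then show ?thesis
    unfolding u v concat_map_join[OF lenU[symmetric]] concat_map_join[OF lenV[symmetric]] img_def by simp
qed

lemma zigzag_satisfies_few_letters:
  assumes "odd n" "3 \<le> n" "satisfies M_zimin (u, v)" "card (set u) < n" "card (set v) < n"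
  shows "satisfies (word_monoid (zigzag_factors n)) (u, v)"
proof -
  interpret factorial_language "zigzag_factors n"
    by (rule factorial_zigzag_factors) (use assms(2) in simp)
  have "satisfies M_zimin (v, u)" using assms(3) satisfies_sym by blast
  then have "concat (map g u) = concat (map g v)"
    if "concat (map g u) \<in> zigzag_factors n \<or> concat (map g v) \<in> zigzag_factors n" for g
    using that few_letters_image_determined[OF assms(1,2,3,4), of g]
      few_letters_image_determined[OF assms(1,2) _ assms(5), of u g]
    unfolding zigzag_factors_def mem_Collect_eq by argo
  then show ?thesis unfolding satisfies_word_monoid by blast
qed

section \<open>Independent identities and the number of varieties\<close>

lemma card_zigzag_identity_letters:
  "card (set (fst (zigzag_identity n))) \<le> 3 * n + 1" "card (set (snd (zigzag_identity n))) \<le> 3 * n + 1"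
proof -
  let ?A = "insert 0 (vtx ` {..<n} \<union> sep ` {..<2 * n})"
  have "card (vtx ` {..<n} \<union> sep ` {..<2 * n}) \<le> n + 2 * n"
    using card_image_le[of "{..<n}" vtx] card_image_le[of "{..<2 * n}" sep]
      card_Un_le[of "vtx ` {..<n}" "sep ` {..<2 * n}"] by simp
  then have A: "card ?A \<le> 3 * n + 1"
    using card_insert_le_m1[of "3 * n + 1" "vtx ` {..<n} \<union> sep ` {..<2 * n}" 0] by simp
  have "set (interleave 0 c) = insert 0 (set c)" for c :: word
    by (induction c) auto
  then have "set (fst (zigzag_identity n)) \<subseteq> ?A" "set (snd (zigzag_identity n)) \<subseteq> ?A"
    using set_cycle_word[of n] by (auto simp: zigzag_identity_def zigzag_def)
  then show "card (set (fst (zigzag_identity n))) \<le> 3 * n + 1" "card (set (snd (zigzag_identity n))) \<le> 3 * n + 1"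
    using card_mono[of ?A] A by (meson finite.insertI finite_UnI finite_imageI finite_lessThan order_trans)+
qed

text \<open>Identities of longer cycles hold by length. Those of shorter cycles hold because their
  at most \<open>3 * 5 ^ Suc j + 1\<close> letters are fewer than \<open>5 ^ Suc i\<close>.\<close>

lemma zigzag_identities_independent:
  assumes "i \<noteq> j"
  shows "satisfies (word_monoid (zigzag_factors (5 ^ Suc i))) (zigzag_identity (5 ^ Suc j))"
proof (cases "i < j")
  case True
  then have "(5 :: nat) ^ Suc (Suc i) \<le> 5 ^ Suc j" by (intro power_increasing) auto
  moreover have "0 < (5 :: nat) ^ i" by simp
  ultimately have "2 \<le> (5 :: nat) ^ Suc i" "2 * 5 ^ Suc i < (5 :: nat) ^ Suc j"
    unfolding power_Suc by linarith+
  then show ?thesis by (rule longer_zigzag_identity_holds)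
next
  case False
  then have "(5 :: nat) ^ Suc (Suc j) \<le> 5 ^ Suc i" using assms by (intro power_increasing) auto
  moreover have "0 < (5 :: nat) ^ j" by simp
  ultimately have "3 * 5 ^ Suc j + 1 < (5 :: nat) ^ Suc i" "(3 :: nat) \<le> 5 ^ Suc i"
    unfolding power_Suc by linarith+
  moreover have "satisfies M_zimin (zigzag_identity (5 ^ Suc j))"
    by (rule zimin_satisfies_zigzag_identity) simp
  ultimately show ?thesis
    using card_zigzag_identity_letters[of "5 ^ Suc j"]
      zigzag_satisfies_few_letters[of "5 ^ Suc i" "fst (zigzag_identity (5 ^ Suc j))" "snd (zigzag_identity (5 ^ Suc j))"]
    by simp
qed

text \<open>By Birkhoff's theorem a variety is a set of identities, and there are countably many
  identities.\<close>

lemma card_varieties_le: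
  assumes "infinite (UNIV :: 'u set)"
  shows "{W :: 'u monoid set. monoid_variety W} \<lesssim> (UNIV :: nat set set)"
proof -
  have "inj_on (\<lambda>W :: 'u monoid set. to_nat ` identities W) {W. monoid_variety W}"
  proof (rule inj_onI)
    fix V W :: "'u monoid set"
    assume VW: "V \<in> {W. monoid_variety W}" "W \<in> {W. monoid_variety W}"
      "to_nat ` identities V = to_nat ` identities W"
    then have "identities V = identities W" by (simp add: inj_image_eq_iff)
    then show "V = W" using VW monoid_variety_eq_models[OF assms] by (metis mem_Collect_eq)
  qed
  then show ?thesis unfolding lepoll_def by blast
qed

theorem mainTheorem2:
  assumes "infinite (UNIV :: 'u set)"
  shows "{W :: 'u monoid set. monoid_variety W \<and>
            generated_variety M_zimin \<subseteq> W \<and>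
            W \<subseteq> models {([0, 0, 1], [1, 0, 0])} \<inter> generated_variety brandt_monoid}
           \<approx> (UNIV :: nat set set) \<and>
         \<not> (\<exists>\<Sigma> :: identity set. finite \<Sigma> \<and>
               (generated_variety M_zimin :: 'u monoid set) =
                 generated_variety brandt_monoid \<inter> models \<Sigma>)"
    (is "?V \<approx> _ \<and> _")
proof
  define Z where "Z = (\<lambda>n. word_monoid (zigzag_factors n))"
  let ?sq = "([0, 0, 1], [1, 0, 0]) :: identity"
  let ?B = "{e. satisfies brandt_monoid e}"
  have Zmon: "monoid (Z n)" "countable (carrier (Z n))" if "2 \<le> n" for n
    using factorial_language.monoid_word_monoid[OF factorial_zigzag_factors[OF that]]
      factorial_language.countable_word_monoid[OF factorial_zigzag_factors[OF that]] by (simp_all add: Z_def)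
  have ZB: "satisfies (Z n) e" if "2 \<le> n" "e \<in> ?B" for n e
    using factorial_language.satisfies_word_monoid_of_isoterms[OF factorial_zigzag_factors[OF that(1)]
        monoid_brandt zigzag_factors_isoterms[OF that(1)], of "fst e" "snd e"] that(2) by (simp add: Z_def)
  have Zsq: "satisfies (Z n) ?sq" if "2 \<le> n" for n
    unfolding Z_def by (rule factorial_language.satisfies_square_central
        [OF factorial_zigzag_factors[OF that] zigzag_factors_isoterms[OF that]])
  have MB: "satisfies M_zimin e" if "e \<in> ?B" for e
    using zimin.satisfies_word_monoid_of_isoterms[OF monoid_brandt zimin_factors_isoterms, of "fst e" "snd e"] that
    by (simp add: M_zimin_eq)
  have Msq: "satisfies M_zimin ?sq"
    unfolding M_zimin_eq by (rule zimin.satisfies_square_central[OF zimin_factors_isoterms])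
  have "range brandt_class = carrier brandt_monoid" by (simp add: brandt_monoid_def)
  then have cB: "countable (carrier brandt_monoid)"
    using card_brandt by (intro countable_finite) (metis card.infinite zero_neq_numeral)
  have cM: "countable (carrier M_zimin)" unfolding M_zimin_eq by (rule zimin.countable_word_monoid)
  have B: "(models ?B :: 'u monoid set) \<subseteq> generated_variety brandt_monoid"
    by (rule models_subset_generated_variety[OF assms monoid_brandt cB])
  have five: "(2 :: nat) \<le> 5 ^ Suc i" for i by (rule order_trans[of _ "5 * 1"]) auto
  show "?V \<approx> (UNIV :: nat set set)"
  proof (rule lepoll_antisym)
    have "?V \<subseteq> {W. monoid_variety W}" by blast
    then show "?V \<lesssim> (UNIV :: nat set set)"
      using card_varieties_le[OF assms] subset_imp_lepoll lepoll_trans by blast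
    \<comment> \<open>The identities with index in \<open>T\<close> are left out, so that the monoid
      of the \<open>i\<close>-th zigzag word belongs to \<open>W T\<close> exactly when
      \<open>i\<close> is in \<open>T\<close>.\<close>
    define W :: "nat set \<Rightarrow> 'u monoid set" where
      "W = (\<lambda>T. models (?B \<union> {?sq} \<union> (\<lambda>j. zigzag_identity (5 ^ Suc j)) ` (- T)))"
    have "W T \<in> ?V" for T
    proof -
      have "monoid_variety (W T)" unfolding W_def by (rule monoid_variety_models)
      moreover have "generated_variety M_zimin \<subseteq> W T"
        unfolding W_def
        by (rule generated_variety_subset_models[OF monoid_M_zimin])
          (use MB Msq zimin_satisfies_zigzag_identity in auto)
      moreover have "W T \<subseteq> models {?sq}" "W T \<subseteq> models ?B" unfolding W_def models_def by auto
      ultimately show ?thesis using B by blast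
    qed
    moreover have W_subset: "T \<subseteq> T'" if eq: "W T = W T'" for T T'
    proof
      fix i assume i: "i \<in> T"
      show "i \<in> T'"
      proof (rule ccontr)
        assume i': "i \<notin> T'"
        \<comment> \<open>This monoid satisfies everything imposed on \<open>W T\<close>, where its
          own identity is left out, but violates that identity, which is imposed on
          \<open>W T'\<close>.\<close>
        let ?Z = "Z (5 ^ Suc i)"
        obtain N :: "'u monoid" where N: "monoid N" "?Z \<cong> N"
          using countable_monoid_copy[OF assms Zmon[OF five]] by blast
        note iso = iso_satisfies_iff[OF N(2) Zmon(1)[OF five] N(1)]
        have "satisfies ?Z (zigzag_identity (5 ^ Suc j))" if "j \<notin> T" for j
          unfolding Z_def by (rule zigzag_identities_independent) (use i that in blast)
        then have "satisfies N e" if "e \<in> ?B \<union> {?sq} \<union> (\<lambda>j. zigzag_identity (5 ^ Suc j)) ` (- T)" for e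
          using that ZB[OF five] Zsq[OF five] unfolding iso[symmetric] by blast
        then have "N \<in> W T" using N(1) unfolding W_def models_def by blast
        then have "N \<in> W T'" using eq by simp
        then have "satisfies N (zigzag_identity (5 ^ Suc i))" using i' unfolding W_def models_def by blast
        then show False using zigzag_identity_fails[OF five] unfolding iso[symmetric] Z_def by blast
      qed
    qed
    ultimately have "inj W \<and> range W \<subseteq> ?V"
      by (intro conjI injI subset_antisym) auto
    then show "(UNIV :: nat set set) \<lesssim> ?V" unfolding lepoll_def by blast
  qed
  show "\<not> (\<exists>\<Sigma>. finite \<Sigma> \<and>
      (generated_variety M_zimin :: 'u monoid set) = generated_variety brandt_monoid \<inter> models \<Sigma>)"
  proof
    assume "\<exists>\<Sigma>. finite \<Sigma> \<and>
      (generated_variety M_zimin :: 'u monoid set) = generated_variety brandt_monoid \<inter> models \<Sigma>"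
    then obtain \<Sigma> where fin: "finite \<Sigma>"
      and eq: "(generated_variety M_zimin :: 'u monoid set) = generated_variety brandt_monoid \<inter> models \<Sigma>"
      by blast
    obtain M :: "'u monoid" where M: "monoid M" "M_zimin \<cong> M"
      using countable_monoid_copy[OF assms monoid_M_zimin cM] by blast
    have "M \<in> models \<Sigma>" using copy_in_generated_variety[OF M] eq by blast
    then have sat: "satisfies M_zimin e" if "e \<in> \<Sigma>" for e
      using that iso_satisfies_iff[OF M(2) monoid_M_zimin M(1)] by (auto simp: models_def)
    let ?c = "\<lambda>e :: identity. card (set (fst e)) + card (set (snd e))"
    obtain k where k: "\<And>e. e \<in> \<Sigma> \<Longrightarrow> ?c e \<le> k"
      using fin finite_nat_set_iff_bounded_le[of "?c ` \<Sigma>"] by auto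
    \<comment> \<open>An odd number, at least 3, above the number of letters on either side of every
      identity in \<open>\<Sigma>\<close>. A copy of \<open>Z n\<close> then lies in the Brandt
      variety and in \<open>models \<Sigma>\<close>, yet violates an identity of the Zimin
      monoid.\<close>
    define n where "n = 2 * k + 3"
    have n: "odd n" "3 \<le> n" "2 \<le> n" by (simp_all add: n_def)
    have Z\<Sigma>: "satisfies (Z n) e" if "e \<in> \<Sigma>" for e
      using zigzag_satisfies_few_letters[OF n(1,2), of "fst e" "snd e"] sat[OF that] k[OF that]
      by (simp add: Z_def n_def)
    obtain N :: "'u monoid" where N: "monoid N" "Z n \<cong> N"
      using countable_monoid_copy[OF assms Zmon[OF n(3)]] by blast
    note iso = iso_satisfies_iff[OF N(2) Zmon(1)[OF n(3)] N(1)]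
    have "N \<in> models ?B" using N(1) ZB[OF n(3)] by (auto simp: models_def iso[symmetric])
    moreover have "N \<in> models \<Sigma>" using N(1) Z\<Sigma> by (auto simp: models_def iso[symmetric])
    ultimately have "N \<in> generated_variety M_zimin" using B eq by blast
    also have "generated_variety M_zimin \<subseteq> models {zigzag_identity n}"
      by (rule generated_variety_subset_models[OF monoid_M_zimin])
        (use zimin_satisfies_zigzag_identity[OF n(1)] in auto)
    finally have "satisfies N (zigzag_identity n)" by (simp add: models_def)
    then show False using zigzag_identity_fails[OF n(3)] unfolding iso[symmetric] Z_def by blast
  qed
qed

end
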